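(* Let $\mathcal M$ be a $\mathbb Z$-graded manifold equipped with a homological vector field $\mathcal Q$ and a Poisson bracket $\{\cdot,\cdot\}_k$ of degree $k\in\mathbb Z$, and let $\pi^\sharp\colon\Omega^1(\mathcal M)\to\mathfrak X(\mathcal M)$ be the induced map. Then $(\mathcal M,\mathcal Q,\{\cdot,\cdot\}_k)$ is a $\mathcal{PQ}$-manifold if and only if $\pi^\sharp$ is a degree $k$ anti-morphism of left differential graded $\mathcal M$-modules from $(\Omega^1(\mathcal M),\pounds_{\mathcal Q})$ to $(\mathfrak X(\mathcal M),\pounds_{\mathcal Q})$, or equivalently if and only if it is a morphism of right differential graded $\mathcal M$-modules from $(\Omega^1(\mathcal M),-\pounds_{\mathcal Q})$ to $(\mathfrak X(\mathcal M),\pounds_{\mathcal Q})$; both conditions mean $$\pi^\sharp\circ\pounds_{\mathcal Q}=-\pounds_{\mathcal Q}\circ\pi^\sharp .$$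
   Context: A $\mathbb Z$-graded manifold $\mathcal M$ over a smooth manifold $M$ is a sheaf $\mathcal C^\infty(\mathcal M)$ on $M$ of $\mathbb Z$-graded, graded commutative, unital $C^\infty(M)$-algebras locally isomorphic to $C^\infty(U)\otimes \underline S(\underline V)$, with $\underline V$ a fixed finite-dimensional $\mathbb Z$-graded vector space and $\underline S$ the graded symmetric algebra. $\mathfrak X(\mathcal M)$ is the $\mathcal C^\infty(\mathcal M)$-module of graded derivations of $\mathcal C^\infty(\mathcal M)$, with graded commutator $[\cdot,\cdot]$; $|\cdot|$ denotes degree. A homological vector field is $\mathcal Q\in\mathfrak X(\mathcal M)$ of degree $1$ with $\mathcal Q^2=0$. A Poisson bracket of degree $k$ is an $\mathbb R$-bilinear map $\{\cdot,\cdot\}_k$ on $\mathcal C^\infty(\mathcal M)$ with $|\{\xi_1,\xi_2\}_k|=|\xi_1|+|\xi_2|+k$ such that, for homogeneous elements, $\{\xi_1,\xi_2\}_k=-(-1)^{(|\xi_1|+k)(|\xi_2|+k)}\{\xi_2,\xi_1\}_k$, $\{\xi_1,\xi_2\xi_3\}_k=\{\xi_1,\xi_2\}_k\xi_3+(-1)^{(|\xi_1|+k)|\xi_2|}\xi_2\{\xi_1,\xi_3\}_k$, and $\{\xi_1,\{\xi_2,\xi_3\}_k\}_k=\{\{\xi_1,\xi_2\}_k,\xi_3\}_k+(-1)^{(|\xi_1|+k)(|\xi_2|+k)}\{\xi_2,\{\xi_1,\xi_3\}_k\}_k$. $(\mathcal M,\mathcal Q,\{\cdot,\cdot\}_k)$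 is a $\mathcal{PQ}$-manifold if $\mathcal Q\{\xi_1,\xi_2\}_k=\{\mathcal Q(\xi_1),\xi_2\}_k+(-1)^{|\xi_1|+k}\{\xi_1,\mathcal Q(\xi_2)\}_k$ for all homogeneous $\xi_1,\xi_2$. $\Omega^1(\mathcal M)$ is the module of $1$-forms, generated over $\mathcal C^\infty(\mathcal M)$ by the $\mathrm d\xi$, with $\mathrm d(\xi_1\xi_2)=(\mathrm d\xi_1)\xi_2+(-1)^{|\xi_1|}\xi_1\mathrm d\xi_2$ and $(\mathrm d\xi_1)\xi_2=(-1)^{(|\xi_1|+1)|\xi_2|}\xi_2\,\mathrm d\xi_1$. On $\mathfrak X(\mathcal M)$, $\pounds_{\mathcal Q}=[\mathcal Q,\cdot]$ (adjoint module). On $\Omega^1(\mathcal M)$, $\pounds_{\mathcal Q}=i_{\mathcal Q}\circ \mathrm d-\mathrm d\circ i_{\mathcal Q}$ (with $i_{\mathcal Q}\xi=0$, $i_{\mathcal Q}\mathrm d\xi=\mathcal Q(\xi)$), so $\pounds_{\mathcal Q}(\mathrm d\xi)=-\mathrm d(\mathcal Q(\xi))$ and $\pounds_{\mathcal Q}(\xi\eta)=\mathcal Q(\xi)\eta+(-1)^{|\xi|}\xi\pounds_{\mathcal Q}(\eta)$ (left coadjoint module); the right coadjoint module is $\Omega^1(\mathcal M)$ with differential $-\pounds_{\mathcal Q}$. The map $\pi^\sharp$ is defined by $\pi^\sharp(\mathrm d\xi_1)(\xi_2)=\{\xi_1,\xi_2\}_k$ and extended by $\pi^\sharp(\xi_1\mathrm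 d\xi_2)=(-1)^{|\xi_1|}\xi_1\,\pi^\sharp(\mathrm d\xi_2)$, $\pi^\sharp((\mathrm d\xi_1)\xi_2)=(-1)^{|\xi_2|}\pi^\sharp(\mathrm d\xi_1)\,\xi_2$, where in the target the right multiplication is $\mathcal X\xi=(-1)^{|\xi|(|\mathcal X|+1-k)}\xi\mathcal X$. "Anti-morphism" (respectively "morphism") refers to anticommuting (respectively commuting) with the module differentials; the compatibility with the module structures is the linearity built into the definition of $\pi^\sharp$. *)

theory Defs
  imports "HOL-Analysis.Analysis" "HOL-Algebra.Module"
begin

section \<open>Smooth manifolds\<close>

text \<open>
  Charts take values in the library's \<^term>\<open>Euclidean_space n\<close>, i.e. functions
  \<^typ>\<open>nat \<Rightarrow> real\<close> vanishing from index \<^term>\<open>n\<close> on, so that dimension 0 (a point, or a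
  discrete set) is included. On an open set, being of class \<open>C\<^sup>k\<close> means that all iterated
  partial derivatives up to order \<open>k\<close> exist and are continuous.
\<close>

fun C_k_on :: "nat \<Rightarrow> nat \<Rightarrow> (nat \<Rightarrow> real) set \<Rightarrow> ((nat \<Rightarrow> real) \<Rightarrow> real) \<Rightarrow> bool" where
  "C_k_on n 0 S f \<longleftrightarrow> continuous_map (subtopology (Euclidean_space n) S) euclideanreal f"
| "C_k_on n (Suc k) S f \<longleftrightarrow>
     continuous_map (subtopology (Euclidean_space n) S) euclideanreal f \<and>
     (\<forall>i<n. \<exists>g. C_k_on n k S g \<and>
        (\<forall>x\<in>S. ((\<lambda>t. f (x(i := t))) has_real_derivative g x) (at (x i))))"

definition smooth_on :: "nat \<Rightarrow> (nat \<Rightarrow> real) set \<Rightarrow> ((nat \<Rightarrow> real) \<Rightarrow> real) \<Rightarrow> bool" where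
  "smooth_on n S f \<longleftrightarrow> (\<forall>k. C_k_on n k S f)"

type_synonym 'm chart = "'m set \<times> ('m \<Rightarrow> nat \<Rightarrow> real)"

definition is_chart :: "'m topology \<Rightarrow> nat \<Rightarrow> 'm chart \<Rightarrow> bool" where
  "is_chart X n c \<longleftrightarrow> (case c of (U, \<phi>) \<Rightarrow>
     openin X U \<and> openin (Euclidean_space n) (\<phi> ` U) \<and>
     homeomorphic_map (subtopology X U) (subtopology (Euclidean_space n) (\<phi> ` U)) \<phi>)"

definition smooth_manifold :: "'m topology \<Rightarrow> nat \<Rightarrow> 'm chart set \<Rightarrow> bool" where
  "smooth_manifold X n atlas \<longleftrightarrow>
     Hausdorff_space X \<and> second_countable X \<and>
     (\<forall>c\<in>atlas. is_chart X n c) \<and>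
     topspace X = (\<Union>(U, \<phi>)\<in>atlas. U) \<and>
     (\<forall>(U, \<phi>)\<in>atlas. \<forall>(V, \<psi>)\<in>atlas. \<forall>i<n.
        smooth_on n (\<phi> ` (U \<inter> V)) (\<lambda>y. \<psi> (inv_into U \<phi> y) i))"

definition smooth_fun :: "nat \<Rightarrow> 'm chart set \<Rightarrow> 'm set \<Rightarrow> ('m \<Rightarrow> real) \<Rightarrow> bool" where
  "smooth_fun n atlas U f \<longleftrightarrow>
     (\<forall>(V, \<phi>)\<in>atlas. smooth_on n (\<phi> ` (U \<inter> V)) (\<lambda>y. f (inv_into V \<phi> y)))"

definition C_inf :: "nat \<Rightarrow> 'm chart set \<Rightarrow> 'm set \<Rightarrow> ('m \<Rightarrow> real) ring" where
  "C_inf n atlas U =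
     \<lparr> carrier = {f \<in> extensional U. smooth_fun n atlas U f},
       monoid.mult = (\<lambda>f g. \<lambda>x\<in>U. f x * g x),
       one = (\<lambda>x\<in>U. 1),
       zero = (\<lambda>x\<in>U. 0),
       add = (\<lambda>f g. \<lambda>x\<in>U. f x + g x) \<rparr>"


section \<open>Graded commutative algebras\<close>

record ('r, 'a) graded_alg = "('r, 'a) module" +
  gpart :: "int \<Rightarrow> 'a set"

definition ksign :: "('r, 'a) graded_alg \<Rightarrow> int \<Rightarrow> 'a \<Rightarrow> 'a" where
  "ksign A i a = (if even i then a else \<ominus>\<^bsub>A\<^esub> a)"

definition graded_comm_algebra :: "'r ring \<Rightarrow> ('r, 'a) graded_alg \<Rightarrow> bool" where
  "graded_comm_algebra K A \<longleftrightarrow>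
     ring A \<and> Module.module K A \<and>
     (\<forall>f\<in>carrier K. \<forall>a\<in>carrier A. \<forall>b\<in>carrier A.
        f \<odot>\<^bsub>A\<^esub> (a \<otimes>\<^bsub>A\<^esub> b) = (f \<odot>\<^bsub>A\<^esub> a) \<otimes>\<^bsub>A\<^esub> b \<and>
        f \<odot>\<^bsub>A\<^esub> (a \<otimes>\<^bsub>A\<^esub> b) = a \<otimes>\<^bsub>A\<^esub> (f \<odot>\<^bsub>A\<^esub> b)) \<and>
     (\<forall>n. submodule (gpart A n) K A) \<and>
     (\<forall>a\<in>carrier A. \<exists>!c. (\<forall>n. c n \<in> gpart A n) \<and> finite {n. c n \<noteq> \<zero>\<^bsub>A\<^esub>} \<and>
        a = finsum A c {n. c n \<noteq> \<zero>\<^bsub>A\<^esub>}) \<and>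
     \<one>\<^bsub>A\<^esub> \<in> gpart A 0 \<and>
     (\<forall>m n. \<forall>a\<in>gpart A m. \<forall>b\<in>gpart A n.
        a \<otimes>\<^bsub>A\<^esub> b \<in> gpart A (m + n) \<and>
        a \<otimes>\<^bsub>A\<^esub> b = ksign A (m * n) (b \<otimes>\<^bsub>A\<^esub> a))"

definition graded_alg_hom ::
  "'r ring \<Rightarrow> ('r \<Rightarrow> 's) \<Rightarrow> ('r, 'a) graded_alg \<Rightarrow> ('s, 'b) graded_alg \<Rightarrow> ('a \<Rightarrow> 'b) \<Rightarrow> bool" where
  "graded_alg_hom K \<rho> A B h \<longleftrightarrow>
     h \<in> ring_hom A B \<and>
     (\<forall>f\<in>carrier K. \<forall>a\<in>carrier A. h (f \<odot>\<^bsub>A\<^esub> a) = \<rho> f \<odot>\<^bsub>B\<^esub> h a) \<and>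
     (\<forall>n. h ` gpart A n \<subseteq> gpart B n)"


section \<open>Graded manifolds\<close>

record ('m, 'a) graded_sheaf =
  sect :: "'m set \<Rightarrow> ('m \<Rightarrow> real, 'a) graded_alg"
  res :: "'m set \<Rightarrow> 'm set \<Rightarrow> 'a \<Rightarrow> 'a"

text \<open>
  Gluing is required degree by degree: infinitely many sections of unbounded degree have no
  reason to glue to a finite sum of homogeneous ones.
\<close>

definition sheaf_of_graded_algebras ::
  "'m topology \<Rightarrow> nat \<Rightarrow> 'm chart set \<Rightarrow> ('m, 'a) graded_sheaf \<Rightarrow> bool" where
  "sheaf_of_graded_algebras X n atlas F \<longleftrightarrow>
     (\<forall>U. openin X U \<longrightarrow> graded_comm_algebra (C_inf n atlas U) (sect F U)) \<and>
     (\<forall>U V. openin X U \<and> openin X V \<and> V \<subseteq> U \<longrightarrow>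
        graded_alg_hom (C_inf n atlas U) (\<lambda>f. restrict f V) (sect F U) (sect F V) (res F U V)) \<and>
     (\<forall>U. openin X U \<longrightarrow> (\<forall>s\<in>carrier (sect F U). res F U U s = s)) \<and>
     (\<forall>U V W. openin X U \<and> openin X V \<and> openin X W \<and> W \<subseteq> V \<and> V \<subseteq> U \<longrightarrow>
        (\<forall>s\<in>carrier (sect F U). res F V W (res F U V s) = res F U W s)) \<and>
     (\<forall>\<U> d s. (\<forall>U\<in>\<U>. openin X U \<and> s U \<in> gpart (sect F U) d) \<and>
        (\<forall>U\<in>\<U>. \<forall>V\<in>\<U>. res F U (U \<inter> V) (s U) = res F V (U \<inter> V) (s V)) \<longrightarrow>
        (\<exists>!t. t \<in> gpart (sect F (\<Union>\<U>)) d \<and> (\<forall>U\<in>\<U>. res F (\<Union>\<U>) U t = s U)))"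

text \<open>
  The graded vector space \<open>V\<close> is given by the list \<open>ds\<close> of degrees of a homogeneous basis
  \<open>v\<^sub>i\<close> (\<open>i < length ds\<close>). The graded symmetric algebra of \<open>V\<close> then has as basis the ordered
  monomials \<open>v\<^sup>e\<close>, where odd generators have exponent at most 1; the structure constants are
  \<open>v\<^sup>e v\<^sup>f = mono_sign ds e f v\<^bsup>e+f\<^esup>\<close> if \<open>e + f\<close> is again such an exponent, and
  \<open>v\<^sup>e v\<^sup>f = 0\<close> otherwise. The sign comes from moving \<open>v\<^sub>j\<close> in the second factor past
  \<open>v\<^sub>i\<close> in the first one for \<open>j < i\<close>.
\<close>

definition monomials :: "int list \<Rightarrow> (nat \<Rightarrow> nat) set" where
  "monomials ds = {e. (\<forall>i\<ge>length ds. e i = 0) \<and> (\<forall>i<length ds. odd (ds ! i) \<longrightarrow> e i \<le> 1)}"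

definition mono_deg :: "int list \<Rightarrow> (nat \<Rightarrow> nat) \<Rightarrow> int" where
  "mono_deg ds e = (\<Sum>i<length ds. int (e i) * ds ! i)"

definition mono_sign :: "int list \<Rightarrow> (nat \<Rightarrow> nat) \<Rightarrow> (nat \<Rightarrow> nat) \<Rightarrow> real" where
  "mono_sign ds e f =
     (-1) ^ (\<Sum>i<length ds. \<Sum>j<i. if odd (ds ! i) \<and> odd (ds ! j) then e i * f j else 0)"

text \<open>
  The local model is the sheaf of graded algebras associated with
  \<open>W \<mapsto> C\<^sup>\<infinity>(W) \<otimes> S(V)\<close>: a section over \<open>W\<close> is a family of smooth coefficients of the
  monomials that is locally finite and lives in finitely many degrees. If the degrees in
  \<open>ds\<close> are all positive or all negative, there are finitely many monomials in each degree,
  and this is \<open>C\<^sup>\<infinity>(W) \<otimes> S(V)\<close> itself. Otherwise \<open>C\<^sup>\<infinity>(W) \<otimes> S(V)\<close> does not satisfy the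
  gluing axiom, because locally finite families need not be finite.
\<close>

definition local_model ::
  "'m topology \<Rightarrow> nat \<Rightarrow> 'm chart set \<Rightarrow> int list \<Rightarrow> 'm set \<Rightarrow>
     ('m \<Rightarrow> real, (nat \<Rightarrow> nat) \<Rightarrow> 'm \<Rightarrow> real) graded_alg" where
  "local_model X n atlas ds W = (
     let z = (\<lambda>x\<in>W. 0);
         S = {c. (\<forall>e. c e \<in> carrier (C_inf n atlas W)) \<and>
                 (\<forall>e. e \<notin> monomials ds \<longrightarrow> c e = z) \<and>
                 (\<forall>x\<in>W. \<exists>N. openin X N \<and> x \<in> N \<and> N \<subseteq> W \<and> finite {e. \<exists>y\<in>N. c e y \<noteq> 0}) \<and>
                 finite (mono_deg ds ` {e. c e \<noteq> z})}
     in \<lparr> carrier = S,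
          monoid.mult = (\<lambda>b c. \<lambda>g. \<lambda>x\<in>W.
             if g \<in> monomials ds
             then \<Sum>(e, f)\<in>{(e, f). e \<in> monomials ds \<and> f \<in> monomials ds \<and> (\<forall>i. e i + f i = g i)}.
                    mono_sign ds e f * b e x * c f x
             else 0),
          one = (\<lambda>e. \<lambda>x\<in>W. if e = (\<lambda>i. 0) then 1 else 0),
          zero = (\<lambda>e. z),
          add = (\<lambda>b c. \<lambda>e. \<lambda>x\<in>W. b e x + c e x),
          smult = (\<lambda>h c. \<lambda>e. \<lambda>x\<in>W. h x * c e x),
          gpart = (\<lambda>d. {c \<in> S. \<forall>e. c e \<noteq> z \<longrightarrow> mono_deg ds e = d}) \<rparr>)"

definition graded_manifold ::
  "'m topology \<Rightarrow> nat \<Rightarrow> 'm chart set \<Rightarrow> int list \<Rightarrow> ('m, 'a) graded_sheaf \<Rightarrow> bool" where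
  "graded_manifold X n atlas ds F \<longleftrightarrow>
     smooth_manifold X n atlas \<and>
     sheaf_of_graded_algebras X n atlas F \<and>
     (\<forall>x\<in>topspace X. \<exists>U \<Phi>. openin X U \<and> x \<in> U \<and>
        (\<forall>W. openin X W \<and> W \<subseteq> U \<longrightarrow>
           graded_alg_hom (C_inf n atlas W) (\<lambda>f. f) (sect F W) (local_model X n atlas ds W) (\<Phi> W) \<and>
           bij_betw (\<Phi> W) (carrier (sect F W)) (carrier (local_model X n atlas ds W))) \<and>
        (\<forall>W W'. openin X W \<and> openin X W' \<and> W' \<subseteq> W \<and> W \<subseteq> U \<longrightarrow>
           (\<forall>s\<in>carrier (sect F W). \<Phi> W' (res F W W' s) = (\<lambda>e. restrict (\<Phi> W s e) W'))))"

text \<open>The graded algebra of globally defined functions, with real scalars.\<close>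

definition global_functions :: "'m topology \<Rightarrow> ('m, 'a) graded_sheaf \<Rightarrow> (real, 'a) graded_alg" where
  "global_functions X F = (let S = sect F (topspace X) in
     \<lparr> carrier = carrier S, monoid.mult = monoid.mult S, one = one S, zero = zero S, add = add S,
       smult = (\<lambda>r a. (\<lambda>x\<in>topspace X. r) \<odot>\<^bsub>S\<^esub> a),
       gpart = gpart S \<rparr>)"


section \<open>Vector fields\<close>

text \<open>
  From here on \<open>A\<close> is the graded algebra of functions. A graded module is given by its
  homogeneous parts, and operations whose sign depends on a degree take that degree as an
  argument. The only element that lies in several homogeneous parts is zero, for which the
  sign does not matter.
\<close>

type_synonym 'a vf = "'a \<Rightarrow> 'a"

definition derivations :: "(real, 'a) graded_alg \<Rightarrow> int \<Rightarrow> 'a vf set" where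
  "derivations A j = {X \<in> carrier A \<rightarrow>\<^sub>E carrier A.
     (\<forall>a\<in>carrier A. \<forall>b\<in>carrier A. X (a \<oplus>\<^bsub>A\<^esub> b) = X a \<oplus>\<^bsub>A\<^esub> X b) \<and>
     (\<forall>r. \<forall>a\<in>carrier A. X (r \<odot>\<^bsub>A\<^esub> a) = r \<odot>\<^bsub>A\<^esub> X a) \<and>
     (\<forall>n. \<forall>a\<in>gpart A n. X a \<in> gpart A (n + j)) \<and>
     (\<forall>n. \<forall>a\<in>gpart A n. \<forall>b\<in>carrier A.
        X (a \<otimes>\<^bsub>A\<^esub> b) = (X a \<otimes>\<^bsub>A\<^esub> b) \<oplus>\<^bsub>A\<^esub> ksign A (j * n) (a \<otimes>\<^bsub>A\<^esub> X b))}"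

definition vf_add :: "(real, 'a) graded_alg \<Rightarrow> 'a vf \<Rightarrow> 'a vf \<Rightarrow> 'a vf" where
  "vf_add A X Y = (\<lambda>b\<in>carrier A. X b \<oplus>\<^bsub>A\<^esub> Y b)"

definition vf_sign :: "(real, 'a) graded_alg \<Rightarrow> int \<Rightarrow> 'a vf \<Rightarrow> 'a vf" where
  "vf_sign A i X = (\<lambda>b\<in>carrier A. ksign A i (X b))"

definition vf_lmul :: "(real, 'a) graded_alg \<Rightarrow> 'a \<Rightarrow> 'a vf \<Rightarrow> 'a vf" where
  "vf_lmul A a X = (\<lambda>b\<in>carrier A. a \<otimes>\<^bsub>A\<^esub> X b)"

text \<open>Right multiplication of a vector field of degree \<open>j\<close> by a function of degree \<open>m\<close>.\<close>

definition vf_rmul :: "(real, 'a) graded_alg \<Rightarrow> int \<Rightarrow> int \<Rightarrow> 'a vf \<Rightarrow> int \<Rightarrow> 'a \<Rightarrow> 'a vf" where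
  "vf_rmul A k j X m a = vf_sign A (m * (j + 1 - k)) (vf_lmul A a X)"

definition graded_commutator ::
  "(real, 'a) graded_alg \<Rightarrow> int \<Rightarrow> int \<Rightarrow> 'a vf \<Rightarrow> 'a vf \<Rightarrow> 'a vf" where
  "graded_commutator A i j X Y = (\<lambda>b\<in>carrier A. X (Y b) \<ominus>\<^bsub>A\<^esub> ksign A (i * j) (Y (X b)))"

definition homological :: "(real, 'a) graded_alg \<Rightarrow> 'a vf \<Rightarrow> bool" where
  "homological A Q \<longleftrightarrow> Q \<in> derivations A 1 \<and> (\<forall>a\<in>carrier A. Q (Q a) = \<zero>\<^bsub>A\<^esub>)"

definition lie_vf :: "(real, 'a) graded_alg \<Rightarrow> 'a vf \<Rightarrow> int \<Rightarrow> 'a vf \<Rightarrow> 'a vf" where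
  "lie_vf A Q j X = graded_commutator A 1 j Q X"


section \<open>Differential forms of degree one and two\<close>

text \<open>
  A 1-form \<open>\<omega>\<close> is represented by its contractions \<open>X \<mapsto> i\<^sub>X \<omega>\<close> with the homogeneous vector
  fields. Here \<open>d\<xi>\<close> has degree \<open>|\<xi>| + 1\<close>, the contraction \<open>i\<^sub>X\<close> is a derivation of degree
  \<open>|X| - 1\<close> with \<open>i\<^sub>X \<xi> = 0\<close>, \<open>i\<^sub>X d\<xi> = X(\<xi>)\<close>, and all products of forms and functions are
  graded commutative. So \<open>i\<^sub>X (\<omega> a) = (i\<^sub>X \<omega>) a\<close> without sign, and left multiplication is
  \<open>a \<omega> = (-1)\<^bsup>|a||\<omega>|\<^esup> \<omega> a\<close>.
\<close>

type_synonym 'a form = "'a vf \<Rightarrow> 'a"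

definition vector_fields :: "(real, 'a) graded_alg \<Rightarrow> 'a vf set" where
  "vector_fields A = (\<Union>j. derivations A j)"

definition form_add :: "(real, 'a) graded_alg \<Rightarrow> 'a form \<Rightarrow> 'a form \<Rightarrow> 'a form" where
  "form_add A \<omega> \<theta> = (\<lambda>X\<in>vector_fields A. \<omega> X \<oplus>\<^bsub>A\<^esub> \<theta> X)"

definition form_sign :: "(real, 'a) graded_alg \<Rightarrow> int \<Rightarrow> 'a form \<Rightarrow> 'a form" where
  "form_sign A i \<omega> = (\<lambda>X\<in>vector_fields A. ksign A i (\<omega> X))"

definition form_rmul :: "(real, 'a) graded_alg \<Rightarrow> 'a form \<Rightarrow> 'a \<Rightarrow> 'a form" where
  "form_rmul A \<omega> a = (\<lambda>X\<in>vector_fields A. \<omega> X \<otimes>\<^bsub>A\<^esub> a)"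

definition form_lmul :: "(real, 'a) graded_alg \<Rightarrow> int \<Rightarrow> 'a \<Rightarrow> int \<Rightarrow> 'a form \<Rightarrow> 'a form" where
  "form_lmul A m a n \<omega> = form_sign A (m * n) (form_rmul A \<omega> a)"

definition d_fun :: "(real, 'a) graded_alg \<Rightarrow> 'a \<Rightarrow> 'a form" where
  "d_fun A \<xi> = (\<lambda>X\<in>vector_fields A. X \<xi>)"

text \<open>The module of 1-forms of degree \<open>n\<close>, generated over \<open>A\<close> by the differentials of functions.\<close>

inductive one_form :: "(real, 'a) graded_alg \<Rightarrow> int \<Rightarrow> 'a form \<Rightarrow> bool" for A where
  d: "\<xi> \<in> gpart A l \<Longrightarrow> one_form A (l + 1) (d_fun A \<xi>)"
| add: "one_form A n \<omega> \<Longrightarrow> one_form A n \<theta> \<Longrightarrow> one_form A n (form_add A \<omega> \<theta>)"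
| lmul: "a \<in> gpart A m \<Longrightarrow> one_form A n \<omega> \<Longrightarrow> one_form A (m + n) (form_lmul A m a n \<omega>)"

text \<open>
  A 2-form \<open>\<Theta>\<close> is likewise represented by its contractions \<open>i\<^sub>X \<Theta>\<close>, which are 1-forms; the
  first argument is the degree \<open>x\<close> of \<open>X\<close>. For 1-forms \<open>\<omega>\<close>, \<open>\<theta>\<close> of degrees \<open>p\<close>, \<open>q\<close> and a
  function \<open>a\<close> of degree \<open>m\<close>,
  \<open>i\<^sub>X (\<omega> \<theta>) = (i\<^sub>X \<omega>) \<theta> + (-1)\<^bsup>p(x-1)\<^esup> \<omega> (i\<^sub>X \<theta>)\<close> and
  \<open>i\<^sub>X (a \<Theta>) = (-1)\<^bsup>m(x-1)\<^esup> a (i\<^sub>X \<Theta>)\<close>.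
\<close>

type_synonym 'a form2 = "int \<Rightarrow> 'a vf \<Rightarrow> 'a form"

definition form2_zero :: "(real, 'a) graded_alg \<Rightarrow> 'a form2" where
  "form2_zero A = (\<lambda>x. \<lambda>X\<in>derivations A x. \<lambda>Y\<in>vector_fields A. \<zero>\<^bsub>A\<^esub>)"

definition form2_add :: "(real, 'a) graded_alg \<Rightarrow> 'a form2 \<Rightarrow> 'a form2 \<Rightarrow> 'a form2" where
  "form2_add A \<Theta> \<Psi> = (\<lambda>x. \<lambda>X\<in>derivations A x. form_add A (\<Theta> x X) (\<Psi> x X))"

definition form2_sign :: "(real, 'a) graded_alg \<Rightarrow> int \<Rightarrow> 'a form2 \<Rightarrow> 'a form2" where
  "form2_sign A i \<Theta> = (\<lambda>x. \<lambda>X\<in>derivations A x. form_sign A i (\<Theta> x X))"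

definition form2_lmul :: "(real, 'a) graded_alg \<Rightarrow> int \<Rightarrow> 'a \<Rightarrow> int \<Rightarrow> 'a form2 \<Rightarrow> 'a form2" where
  "form2_lmul A m a n \<Theta> = (\<lambda>x. \<lambda>X\<in>derivations A x.
     form_sign A (m * (x - 1)) (form_lmul A m a (n + x - 1) (\<Theta> x X)))"

definition wedge :: "(real, 'a) graded_alg \<Rightarrow> int \<Rightarrow> 'a form \<Rightarrow> int \<Rightarrow> 'a form \<Rightarrow> 'a form2" where
  "wedge A p \<omega> q \<theta> = (\<lambda>x. \<lambda>X\<in>derivations A x.
     form_add A (form_lmul A (p + x - 1) (\<omega> X) q \<theta>)
       (form_sign A (p * (x - 1)) (form_rmul A \<omega> (\<theta> X))))"

text \<open>
  The de Rham differential on 1-forms, as the derivation of degree 1 with \<open>d(d\<xi>) = 0\<close>: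
  \<open>ext_d_graph A n \<omega> \<Theta>\<close> states that \<open>\<Theta> = d\<omega>\<close> for the 1-form \<open>\<omega>\<close> of degree \<open>n\<close>.
  It determines \<open>\<Theta>\<close>, because the rules preserve
  \<open>i\<^sub>Y i\<^sub>X \<Theta> = (-1)\<^bsup>xy+x\<^esup> (X(\<omega> Y) - (-1)\<^bsup>xy\<^esup> Y(\<omega> X) - \<omega> [X,Y])\<close>
  for \<open>X\<close>, \<open>Y\<close> of degrees \<open>x\<close>, \<open>y\<close>.
\<close>

inductive ext_d_graph :: "(real, 'a) graded_alg \<Rightarrow> int \<Rightarrow> 'a form \<Rightarrow> 'a form2 \<Rightarrow> bool" for A where
  d: "\<xi> \<in> gpart A l \<Longrightarrow> ext_d_graph A (l + 1) (d_fun A \<xi>) (form2_zero A)"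
| add: "ext_d_graph A n \<omega> \<Theta> \<Longrightarrow> ext_d_graph A n \<theta> \<Psi> \<Longrightarrow>
     ext_d_graph A n (form_add A \<omega> \<theta>) (form2_add A \<Theta> \<Psi>)"
| lmul: "a \<in> gpart A m \<Longrightarrow> ext_d_graph A n \<omega> \<Theta> \<Longrightarrow>
     ext_d_graph A (m + n) (form_lmul A m a n \<omega>)
       (form2_add A (wedge A (m + 1) (d_fun A a) n \<omega>)
         (form2_sign A m (form2_lmul A m a (n + 1) \<Theta>)))"

definition ext_d :: "(real, 'a) graded_alg \<Rightarrow> int \<Rightarrow> 'a form \<Rightarrow> 'a form2" where
  "ext_d A n \<omega> = (THE \<Theta>. ext_d_graph A n \<omega> \<Theta>)"

text \<open>The Lie derivative \<open>i\<^sub>Q \<circ> d - d \<circ> i\<^sub>Q\<close> along a vector field \<open>Q\<close> of degree 1.\<close>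

definition lie_form :: "(real, 'a) graded_alg \<Rightarrow> 'a vf \<Rightarrow> int \<Rightarrow> 'a form \<Rightarrow> 'a form" where
  "lie_form A Q n \<omega> = form_add A (ext_d A n \<omega> 1 Q) (form_sign A 1 (d_fun A (\<omega> Q)))"


section \<open>Poisson brackets and PQ-manifolds\<close>

definition poisson_bracket :: "(real, 'a) graded_alg \<Rightarrow> int \<Rightarrow> ('a \<Rightarrow> 'a \<Rightarrow> 'a) \<Rightarrow> bool" where
  "poisson_bracket A k br \<longleftrightarrow>
     (\<forall>a\<in>carrier A. \<forall>b\<in>carrier A. br a b \<in> carrier A) \<and>
     (\<forall>a\<in>carrier A. \<forall>b\<in>carrier A. \<forall>c\<in>carrier A.
        br (a \<oplus>\<^bsub>A\<^esub> b) c = br a c \<oplus>\<^bsub>A\<^esub> br b c \<and> br a (b \<oplus>\<^bsub>A\<^esub> c) = br a b \<oplus>\<^bsub>A\<^esub> br a c) \<and>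
     (\<forall>r. \<forall>a\<in>carrier A. \<forall>b\<in>carrier A.
        br (r \<odot>\<^bsub>A\<^esub> a) b = r \<odot>\<^bsub>A\<^esub> br a b \<and> br a (r \<odot>\<^bsub>A\<^esub> b) = r \<odot>\<^bsub>A\<^esub> br a b) \<and>
     (\<forall>p q. \<forall>a\<in>gpart A p. \<forall>b\<in>gpart A q. br a b \<in> gpart A (p + q + k)) \<and>
     (\<forall>p q. \<forall>a\<in>gpart A p. \<forall>b\<in>gpart A q.
        br a b = \<ominus>\<^bsub>A\<^esub> (ksign A ((p + k) * (q + k)) (br b a))) \<and>
     (\<forall>p q r. \<forall>a\<in>gpart A p. \<forall>b\<in>gpart A q. \<forall>c\<in>gpart A r.
        br a (b \<otimes>\<^bsub>A\<^esub> c) = (br a b \<otimes>\<^bsub>A\<^esub> c) \<oplus>\<^bsub>A\<^esub> ksign A ((p + k) * q) (b \<otimes>\<^bsub>A\<^esub> br a c)) \<and>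
     (\<forall>p q r. \<forall>a\<in>gpart A p. \<forall>b\<in>gpart A q. \<forall>c\<in>gpart A r.
        br a (br b c) = br (br a b) c \<oplus>\<^bsub>A\<^esub> ksign A ((p + k) * (q + k)) (br b (br a c)))"

definition PQ_compatible ::
  "(real, 'a) graded_alg \<Rightarrow> 'a vf \<Rightarrow> int \<Rightarrow> ('a \<Rightarrow> 'a \<Rightarrow> 'a) \<Rightarrow> bool" where
  "PQ_compatible A Q k br \<longleftrightarrow>
     (\<forall>p q. \<forall>a\<in>gpart A p. \<forall>b\<in>gpart A q.
        Q (br a b) = br (Q a) b \<oplus>\<^bsub>A\<^esub> ksign A (p + k) (br a (Q b)))"

definition PQ_manifold ::
  "'m topology \<Rightarrow> nat \<Rightarrow> 'm chart set \<Rightarrow> int list \<Rightarrow> ('m, 'a) graded_sheaf \<Rightarrow>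
     'a vf \<Rightarrow> int \<Rightarrow> ('a \<Rightarrow> 'a \<Rightarrow> 'a) \<Rightarrow> bool" where
  "PQ_manifold X n atlas ds F Q k br \<longleftrightarrow>
     graded_manifold X n atlas ds F \<and> homological (global_functions X F) Q \<and>
     poisson_bracket (global_functions X F) k br \<and> PQ_compatible (global_functions X F) Q k br"

text \<open>
  \<open>pi_sharp_graph A k br n \<omega> Y\<close> states that \<open>Y\<close> is the image of the 1-form \<open>\<omega>\<close> of degree \<open>n\<close>.
  Since \<open>d\<xi>\<close> has degree \<open>|\<xi>| + 1\<close> and its image has degree \<open>|\<xi>| + k\<close>, the image of a
  1-form of degree \<open>n\<close> has degree \<open>n - 1 + k\<close>. For a Poisson bracket, \<open>Y\<close> is determined by
  \<open>\<omega>\<close>: on \<open>\<zeta>\<close> of degree \<open>z\<close> it takes the value \<open>-(-1)\<^bsup>(n-1+k)(z+k)\<^esup> \<omega> {\<zeta>, _}\<close>.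
\<close>

inductive pi_sharp_graph ::
  "(real, 'a) graded_alg \<Rightarrow> int \<Rightarrow> ('a \<Rightarrow> 'a \<Rightarrow> 'a) \<Rightarrow> int \<Rightarrow> 'a form \<Rightarrow> 'a vf \<Rightarrow> bool"
  for A k br where
  d: "\<xi> \<in> gpart A l \<Longrightarrow>
     pi_sharp_graph A k br (l + 1) (d_fun A \<xi>) (\<lambda>\<zeta>\<in>carrier A. br \<xi> \<zeta>)"
| add: "pi_sharp_graph A k br n \<omega> Y \<Longrightarrow> pi_sharp_graph A k br n \<theta> Z \<Longrightarrow>
     pi_sharp_graph A k br n (form_add A \<omega> \<theta>) (vf_add A Y Z)"
| lmul: "a \<in> gpart A m \<Longrightarrow> pi_sharp_graph A k br n \<omega> Y \<Longrightarrow>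
     pi_sharp_graph A k br (m + n) (form_lmul A m a n \<omega>) (vf_sign A m (vf_lmul A a Y))"
| rmul: "a \<in> gpart A m \<Longrightarrow> pi_sharp_graph A k br n \<omega> Y \<Longrightarrow>
     pi_sharp_graph A k br (n + m) (form_rmul A \<omega> a) (vf_sign A m (vf_rmul A k (n - 1 + k) Y m a))"

definition pi_sharp ::
  "(real, 'a) graded_alg \<Rightarrow> int \<Rightarrow> ('a \<Rightarrow> 'a \<Rightarrow> 'a) \<Rightarrow> int \<Rightarrow> 'a form \<Rightarrow> 'a vf" where
  "pi_sharp A k br n \<omega> = (THE Y. pi_sharp_graph A k br n \<omega> Y)"


section \<open>Morphisms of differential graded modules\<close>

text \<open>
  In \<open>lact a m w n\<close> and \<open>ract w n a m\<close>, \<open>m\<close> is the degree of the function \<open>a\<close> and \<open>n\<close>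
  that of the module element \<open>w\<close>.
\<close>

record ('a, 'b) dg_module =
  part :: "int \<Rightarrow> 'b set"
  madd :: "'b \<Rightarrow> 'b \<Rightarrow> 'b"
  msign :: "int \<Rightarrow> 'b \<Rightarrow> 'b"
  lact :: "'a \<Rightarrow> int \<Rightarrow> 'b \<Rightarrow> int \<Rightarrow> 'b"
  ract :: "'b \<Rightarrow> int \<Rightarrow> 'a \<Rightarrow> int \<Rightarrow> 'b"
  mdiff :: "int \<Rightarrow> 'b \<Rightarrow> 'b"

definition forms_module ::
  "(real, 'a) graded_alg \<Rightarrow> (int \<Rightarrow> 'a form \<Rightarrow> 'a form) \<Rightarrow> ('a, 'a form) dg_module" where
  "forms_module A D =
     \<lparr> part = (\<lambda>n. {\<omega>. one_form A n \<omega>}),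
       madd = form_add A,
       msign = form_sign A,
       lact = (\<lambda>a m \<omega> n. form_lmul A m a n \<omega>),
       ract = (\<lambda>\<omega> n a m. form_rmul A \<omega> a),
       mdiff = D \<rparr>"

definition vf_module ::
  "(real, 'a) graded_alg \<Rightarrow> int \<Rightarrow> (int \<Rightarrow> 'a vf \<Rightarrow> 'a vf) \<Rightarrow> ('a, 'a vf) dg_module" where
  "vf_module A k D =
     \<lparr> part = derivations A,
       madd = vf_add A,
       msign = vf_sign A,
       lact = (\<lambda>a m X j. vf_lmul A a X),
       ract = (\<lambda>X j a m. vf_rmul A k j X m a),
       mdiff = D \<rparr>"

text \<open>
  A map of degree \<open>k\<close> on 1-forms is counted so that \<open>d\<xi>\<close> goes to degree \<open>|\<xi>| + k\<close>;
  \<open>P n\<close> is its component on elements of degree \<open>n\<close>.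
\<close>

definition graded_map ::
  "int \<Rightarrow> ('a, 'b) dg_module \<Rightarrow> ('a, 'c) dg_module \<Rightarrow> (int \<Rightarrow> 'b \<Rightarrow> 'c) \<Rightarrow> bool" where
  "graded_map k M N P \<longleftrightarrow>
     (\<forall>n. \<forall>w\<in>part M n. P n w \<in> part N (n - 1 + k)) \<and>
     (\<forall>n. \<forall>w\<in>part M n. \<forall>v\<in>part M n. P n (madd M w v) = madd N (P n w) (P n v))"

definition left_dg_anti_morphism ::
  "(real, 'a) graded_alg \<Rightarrow> int \<Rightarrow> ('a, 'b) dg_module \<Rightarrow> ('a, 'c) dg_module \<Rightarrow>
     (int \<Rightarrow> 'b \<Rightarrow> 'c) \<Rightarrow> bool" where
  "left_dg_anti_morphism A k M N P \<longleftrightarrow>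
     graded_map k M N P \<and>
     (\<forall>m n. \<forall>a\<in>gpart A m. \<forall>w\<in>part M n.
        P (m + n) (lact M a m w n) = msign N m (lact N a m (P n w) (n - 1 + k))) \<and>
     (\<forall>n. \<forall>w\<in>part M n. P (n + 1) (mdiff M n w) = msign N 1 (mdiff N (n - 1 + k) (P n w)))"

definition right_dg_morphism ::
  "(real, 'a) graded_alg \<Rightarrow> int \<Rightarrow> ('a, 'b) dg_module \<Rightarrow> ('a, 'c) dg_module \<Rightarrow>
     (int \<Rightarrow> 'b \<Rightarrow> 'c) \<Rightarrow> bool" where
  "right_dg_morphism A k M N P \<longleftrightarrow>
     graded_map k M N P \<and>
     (\<forall>m n. \<forall>a\<in>gpart A m. \<forall>w\<in>part M n.
        P (n + m) (ract M w n a m) = msign N m (ract N (P n w) (n - 1 + k) a m)) \<and>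
     (\<forall>n. \<forall>w\<in>part M n. P (n + 1) (mdiff M n w) = mdiff N (n - 1 + k) (P n w))"

end

theory Submission
  imports Defs
begin

text \<open>
  Both \<open>\<pi>\<^sup>\<sharp> \<circ> \<pounds>\<^sub>Q\<close> and \<open>- \<pounds>\<^sub>Q \<circ> \<pi>\<^sup>\<sharp>\<close> are additive and send \<open>a \<omega>\<close> to the same combination of
  \<open>Q(a) \<pi>\<^sup>\<sharp>(\<omega>)\<close> and of \<open>a\<close> times their value at \<open>\<omega>\<close>, so they agree on all 1-forms as soon as they
  agree on the generators \<open>d\<xi>\<close>. There, evaluated at \<open>\<zeta>\<close>, their equality is the derivation
  property of \<open>Q\<close> for \<open>{\<xi>, \<zeta>}\<close>. The differential and \<open>\<pi>\<^sup>\<sharp>\<close> are well defined on the forms because both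
  are given by evaluating forms: the former by Cartan's formula, the latter by
  \<open>\<pi>\<^sup>\<sharp>(\<omega>)(\<zeta>) = \<plusminus> \<omega>({\<zeta>, _})\<close>. Cartan's formula also gives
  \<open>(\<pounds>\<^sub>Q \<omega>)(Y) = (-1)\<^bsup>|Y|+1\<^esup> (Q(\<omega>(Y)) - \<omega>([Q,Y]))\<close>.
\<close>

section \<open>Graded commutative algebras and their derivations\<close>

locale graded_algebra = ring A for A :: "(real, 'a) graded_alg" (structure) +
  assumes smult_closed [simp]: "a \<in> carrier A \<Longrightarrow> r \<odot> a \<in> carrier A"
    and smult_add: "a \<in> carrier A \<Longrightarrow> b \<in> carrier A \<Longrightarrow> r \<odot> (a \<oplus> b) = r \<odot> a \<oplus> r \<odot> b"
    and smult_mult_right: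
      "a \<in> carrier A \<Longrightarrow> b \<in> carrier A \<Longrightarrow> r \<odot> (a \<otimes> b) = a \<otimes> (r \<odot> b)"
    and gpart_carrier: "a \<in> gpart A n \<Longrightarrow> a \<in> carrier A"
    and gpart_add: "a \<in> gpart A n \<Longrightarrow> b \<in> gpart A n \<Longrightarrow> a \<oplus> b \<in> gpart A n"
    and gpart_neg: "a \<in> gpart A n \<Longrightarrow> \<ominus> a \<in> gpart A n"
    and gpart_one: "\<one> \<in> gpart A 0"
    and gpart_mult: "a \<in> gpart A m \<Longrightarrow> b \<in> gpart A n \<Longrightarrow> a \<otimes> b \<in> gpart A (m + n)"
    and graded_comm:
      "a \<in> gpart A m \<Longrightarrow> b \<in> gpart A n \<Longrightarrow> a \<otimes> b = ksign A (m * n) (b \<otimes> a)"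
    and homogeneous_sum: "a \<in> carrier A \<Longrightarrow>
      \<exists>c I. finite I \<and> (\<forall>n. c n \<in> gpart A n) \<and> a = finsum A c (I :: int set)"
begin

lemma smult_neg:
  assumes "a \<in> carrier A"
  shows "r \<odot> (\<ominus> a) = \<ominus> (r \<odot> a)"
proof -
  have z: "r \<odot> \<zero> = \<zero>"
    using smult_add[of \<zero> \<zero> r] by (metis add.r_cancel_one' smult_closed l_zero zero_closed)
  have "r \<odot> (\<ominus> a) \<oplus> r \<odot> a = \<zero>"
    using assms smult_add[of "\<ominus> a" a r] z by (simp add: l_neg)
  then show ?thesis
    using assms by (simp add: minus_equality)
qed

lemma ksign_closed [simp]: "a \<in> carrier A \<Longrightarrow> ksign A i a \<in> carrier A"
  by (simp add: ksign_def)

lemma ksign_add: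
  "a \<in> carrier A \<Longrightarrow> b \<in> carrier A \<Longrightarrow> ksign A i (a \<oplus> b) = ksign A i a \<oplus> ksign A i b"
  by (simp add: ksign_def minus_add)

lemma gpart_ksign: "a \<in> gpart A n \<Longrightarrow> ksign A i a \<in> gpart A n"
  by (simp add: ksign_def gpart_neg)

lemma homogeneous_induct [consumes 1, case_names homogeneous add]:
  assumes "a \<in> carrier A"
    and hom: "\<And>n a. a \<in> gpart A n \<Longrightarrow> P a"
    and add: "\<And>a b. a \<in> carrier A \<Longrightarrow> b \<in> carrier A \<Longrightarrow> P a \<Longrightarrow> P b \<Longrightarrow> P (a \<oplus> b)"
  shows "P a"
proof -
  obtain c and I :: "int set" where c: "finite I" "\<forall>n. c n \<in> gpart A n" "a = finsum A c I"
    using homogeneous_sum[OF assms(1)] by blast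
  have cc: "c n \<in> carrier A" for n
    using c(2) gpart_carrier by blast
  have "\<one> \<oplus> \<ominus> \<one> \<in> gpart A 0"
    using gpart_add gpart_one gpart_neg by blast
  then have "P \<zero>"
    using hom by (simp add: r_neg)
  with \<open>finite I\<close> have "P (finsum A c I)"
  proof (induction I)
    case (insert i I)
    then show ?case
      using cc c(2) by (auto intro!: add hom[of "c i" i] finsum_closed)
  qed simp
  then show ?thesis using c(3) by simp
qed

lemma derivationsD:
  assumes "X \<in> derivations A j"
  shows derivation_extensional: "X \<in> extensional (carrier A)"
    and derivation_closed: "a \<in> carrier A \<Longrightarrow> X a \<in> carrier A"
    and derivation_add: "a \<in> carrier A \<Longrightarrow> b \<in> carrier A \<Longrightarrow> X (a \<oplus> b) = X a \<oplus> X b"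
    and derivation_smult: "a \<in> carrier A \<Longrightarrow> X (r \<odot> a) = r \<odot> X a"
    and derivation_gpart: "a \<in> gpart A n \<Longrightarrow> X a \<in> gpart A (n + j)"
    and derivation_mult: "a \<in> gpart A n \<Longrightarrow> b \<in> carrier A \<Longrightarrow>
      X (a \<otimes> b) = (X a \<otimes> b) \<oplus> ksign A (j * n) (a \<otimes> X b)"
  using assms by (auto simp: derivations_def PiE_def)

lemma derivation_eqI:
  assumes X: "X \<in> derivations A i" and Y: "Y \<in> derivations A j"
    and eq: "\<And>n a. a \<in> gpart A n \<Longrightarrow> X a = Y a"
  shows "X = Y"
proof (rule extensionalityI[OF derivation_extensional[OF X] derivation_extensional[OF Y]])
  fix a assume "a \<in> carrier A"
  then show "X a = Y a"
    by (induction rule: homogeneous_induct)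
      (simp_all add: eq derivation_add[OF X] derivation_add[OF Y])
qed

lemma derivation_neg:
  assumes "X \<in> derivations A j" "a \<in> carrier A"
  shows "X (\<ominus> a) = \<ominus> X a"
proof -
  have "X \<zero> \<oplus> X \<zero> = X \<zero>"
    using derivation_add[OF assms(1), of \<zero> \<zero>] by simp
  then have z: "X \<zero> = \<zero>"
    using derivation_closed[OF assms(1), of \<zero>] by (metis add.r_cancel_one' zero_closed)
  have "X (\<ominus> a) \<oplus> X a = \<zero>"
    using assms derivation_add[OF assms(1), of "\<ominus> a" a] z by (simp add: l_neg)
  then show ?thesis
    using assms derivation_closed[OF assms(1)] by (simp add: minus_equality)
qed

lemma derivation_ksign:
  "X \<in> derivations A j \<Longrightarrow> a \<in> carrier A \<Longrightarrow> X (ksign A i a) = ksign A i (X a)"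
  by (simp add: ksign_def derivation_neg)

lemma derivationsI:
  assumes "X \<in> extensional (carrier A)"
    and "\<And>a. a \<in> carrier A \<Longrightarrow> X a \<in> carrier A"
    and "\<And>a b. a \<in> carrier A \<Longrightarrow> b \<in> carrier A \<Longrightarrow> X (a \<oplus> b) = X a \<oplus> X b"
    and "\<And>r a. a \<in> carrier A \<Longrightarrow> X (r \<odot> a) = r \<odot> X a"
    and "\<And>n a. a \<in> gpart A n \<Longrightarrow> X a \<in> gpart A (n + j)"
    and "\<And>n a b. a \<in> gpart A n \<Longrightarrow> b \<in> carrier A \<Longrightarrow>
      X (a \<otimes> b) = (X a \<otimes> b) \<oplus> ksign A (j * n) (a \<otimes> X b)"
  shows "X \<in> derivations A j"
  using assms by (auto simp: derivations_def PiE_def)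

lemma vf_add_derivation:
  assumes X: "X \<in> derivations A j" and Y: "Y \<in> derivations A j"
  shows "vf_add A X Y \<in> derivations A j"
proof (rule derivationsI)
  fix n a b assume a: "a \<in> gpart A n" and b: "b \<in> carrier A"
  have [simp]: "a \<in> carrier A" using a by (rule gpart_carrier)
  note [simp] = b derivation_closed[OF X] derivation_closed[OF Y]
  show "vf_add A X Y (a \<otimes> b) = (vf_add A X Y a \<otimes> b) \<oplus> ksign A (j * n) (a \<otimes> vf_add A X Y b)"
    by (simp add: vf_add_def derivation_mult[OF X a b] derivation_mult[OF Y a b]
        ksign_add l_distr r_distr a_ac)
qed (auto simp: vf_add_def derivation_closed[OF X] derivation_closed[OF Y] smult_add
    derivation_add[OF X] derivation_add[OF Y] derivation_smult[OF X] derivation_smult[OF Y]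
    a_ac gpart_carrier intro!: gpart_add derivation_gpart[OF X] derivation_gpart[OF Y])

lemma vf_sign_derivation:
  assumes X: "X \<in> derivations A j"
  shows "vf_sign A i X \<in> derivations A j"
proof (rule derivationsI)
  fix n a b assume a: "a \<in> gpart A n" and b: "b \<in> carrier A"
  have [simp]: "a \<in> carrier A" using a by (rule gpart_carrier)
  note [simp] = b derivation_closed[OF X]
  show "vf_sign A i X (a \<otimes> b) =
      (vf_sign A i X a \<otimes> b) \<oplus> ksign A (j * n) (a \<otimes> vf_sign A i X b)"
    by (simp add: vf_sign_def derivation_mult[OF X a b] ksign_def l_minus r_minus minus_add)
qed (auto simp: vf_sign_def derivation_closed[OF X] ksign_add ksign_def smult_neg minus_add
    derivation_add[OF X] derivation_smult[OF X]
    gpart_carrier intro!: gpart_neg derivation_gpart[OF X])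

lemma vf_lmul_derivation:
  assumes a: "a \<in> gpart A m" and X: "X \<in> derivations A j"
  shows "vf_lmul A a X \<in> derivations A (m + j)"
proof (rule derivationsI)
  note [simp] = gpart_carrier[OF a] derivation_closed[OF X]
  fix n b c assume b: "b \<in> gpart A n" and c: "c \<in> carrier A"
  note [simp] = gpart_carrier[OF b] c
  have "a \<otimes> (b \<otimes> X c) = ksign A (m * n) (b \<otimes> a) \<otimes> X c"
    by (simp add: graded_comm[OF a b, symmetric] m_assoc)
  then have ab: "a \<otimes> (b \<otimes> X c) = ksign A (m * n) (b \<otimes> (a \<otimes> X c))"
    by (simp add: ksign_def l_minus m_assoc)
  show "vf_lmul A a X (b \<otimes> c) =
      (vf_lmul A a X b \<otimes> c) \<oplus> ksign A ((m + j) * n) (b \<otimes> vf_lmul A a X c)"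
    using ab by (simp add: vf_lmul_def derivation_mult[OF X b c] ksign_def r_minus r_distr m_assoc)
next
  fix n b assume b: "b \<in> gpart A n"
  show "vf_lmul A a X b \<in> gpart A (n + (m + j))"
    using gpart_mult[OF a derivation_gpart[OF X b]] gpart_carrier[OF b]
    by (simp add: vf_lmul_def add_ac)
qed (auto simp: vf_lmul_def gpart_carrier[OF a] derivation_closed[OF X] r_distr
    derivation_add[OF X] derivation_smult[OF X] smult_mult_right)

lemma commutator_derivation:
  assumes X: "X \<in> derivations A i" and Y: "Y \<in> derivations A j"
  shows "graded_commutator A i j X Y \<in> derivations A (i + j)"
proof (rule derivationsI)
  note [simp] = derivation_closed[OF X] derivation_closed[OF Y]
  fix n b c assume b: "b \<in> gpart A n" and c: "c \<in> carrier A"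
  note [simp] = gpart_carrier[OF b] c
  have XY: "X (Y (b \<otimes> c)) = (X (Y b) \<otimes> c \<oplus> ksign A (i * (n + j)) (Y b \<otimes> X c)) \<oplus>
      ksign A (j * n) (X b \<otimes> Y c \<oplus> ksign A (i * n) (b \<otimes> X (Y c)))"
    by (simp add: derivation_mult[OF Y b c] derivation_add[OF X] derivation_ksign[OF X]
        derivation_mult[OF X b] derivation_mult[OF X derivation_gpart[OF Y b]])
  have YX: "Y (X (b \<otimes> c)) = (Y (X b) \<otimes> c \<oplus> ksign A (j * (n + i)) (X b \<otimes> Y c)) \<oplus>
      ksign A (i * n) (Y b \<otimes> X c \<oplus> ksign A (j * n) (b \<otimes> Y (X c)))"
    by (simp add: derivation_mult[OF X b c] derivation_add[OF Y] derivation_ksign[OF Y]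
        derivation_mult[OF Y b] derivation_mult[OF Y derivation_gpart[OF X b]])
  have cancel: "q \<oplus> (r \<oplus> (s \<oplus> (t \<oplus> (\<ominus> q \<oplus> \<ominus> r)))) = s \<oplus> t"
    if "q \<in> carrier A" "r \<in> carrier A" "s \<in> carrier A" "t \<in> carrier A" for q r s t
  proof -
    have "q \<oplus> (r \<oplus> (s \<oplus> (t \<oplus> (\<ominus> q \<oplus> \<ominus> r)))) =
        (q \<oplus> \<ominus> q) \<oplus> ((r \<oplus> \<ominus> r) \<oplus> (s \<oplus> t))"
      using that by (simp only: a_ac a_inv_closed a_closed)
    then show ?thesis
      using that by (simp add: r_neg)
  qed
  have cancel': "q \<oplus> (r \<oplus> (s \<oplus> (t \<oplus> (\<ominus> q \<oplus> (\<ominus> r \<oplus> u))))) = s \<oplus> (t \<oplus> u)"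
    if "q \<in> carrier A" "r \<in> carrier A" "s \<in> carrier A" "t \<in> carrier A" "u \<in> carrier A"
    for q r s t u
    using cancel[of q r s "t \<oplus> u"] that by (simp add: a_ac)
  show "graded_commutator A i j X Y (b \<otimes> c) = (graded_commutator A i j X Y b \<otimes> c) \<oplus>
      ksign A ((i + j) * n) (b \<otimes> graded_commutator A i j X Y c)"
    unfolding graded_commutator_def
    by (cases "even i"; cases "even j"; cases "even n")
      (simp_all add: XY YX ksign_def a_minus_def l_distr r_distr l_minus r_minus minus_add a_ac
         cancel cancel')
next
  fix n b assume b: "b \<in> gpart A n"
  show "graded_commutator A i j X Y b \<in> gpart A (n + (i + j))"
    using derivation_gpart[OF X derivation_gpart[OF Y b]]
      derivation_gpart[OF Y derivation_gpart[OF X b]] gpart_carrier[OF b]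
    by (auto simp: graded_commutator_def a_minus_def add_ac intro!: gpart_add gpart_neg gpart_ksign)
qed (auto simp: graded_commutator_def derivation_closed[OF X] derivation_closed[OF Y]
   derivation_add[OF X] derivation_add[OF Y] derivation_smult[OF X] derivation_smult[OF Y]
   ksign_def a_minus_def smult_add smult_neg minus_add a_ac)


section \<open>Forms and the Lie derivative\<close>

lemma vector_fieldsI: "X \<in> derivations A j \<Longrightarrow> X \<in> vector_fields A"
  by (auto simp: vector_fields_def)

lemma form_eqI:
  assumes "\<omega> \<in> extensional (vector_fields A)" "\<theta> \<in> extensional (vector_fields A)"
    and "\<And>y Y. Y \<in> derivations A y \<Longrightarrow> \<omega> Y = \<theta> Y"
  shows "\<omega> = \<theta>"
  using assms by (auto intro!: extensionalityI[of _ "vector_fields A"] simp: vector_fields_def)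

lemma form_extensional [simp]:
  "d_fun A \<xi> \<in> extensional (vector_fields A)"
  "form_add A \<omega> \<theta> \<in> extensional (vector_fields A)"
  "form_sign A i \<omega> \<in> extensional (vector_fields A)"
  "form_rmul A \<omega> a \<in> extensional (vector_fields A)"
  "form_lmul A m a n \<omega> \<in> extensional (vector_fields A)"
  by (simp_all add: d_fun_def form_add_def form_sign_def form_rmul_def form_lmul_def)

lemma form_apply:
  assumes "Y \<in> derivations A y"
  shows "d_fun A \<xi> Y = Y \<xi>"
    and "form_add A \<omega> \<theta> Y = \<omega> Y \<oplus> \<theta> Y"
    and "form_sign A i \<omega> Y = ksign A i (\<omega> Y)"
    and "form_rmul A \<omega> a Y = \<omega> Y \<otimes> a"
    and "form_lmul A m a n \<omega> Y = ksign A (m * n) (\<omega> Y \<otimes> a)"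
  using vector_fieldsI[OF assms]
  by (simp_all add: d_fun_def form_add_def form_sign_def form_rmul_def form_lmul_def)

lemma one_form_gpart:
  assumes "one_form A n \<omega>" "Y \<in> derivations A y"
  shows "\<omega> Y \<in> gpart A (n + y - 1)"
  using assms(1)
proof (induction rule: one_form.induct)
  case (d \<xi> l)
  then show ?case
    using derivation_gpart[OF assms(2)] by (simp add: form_apply[OF assms(2)])
next
  case (add n \<omega> \<theta>)
  then show ?case by (simp add: form_apply[OF assms(2)] gpart_add)
next
  case (lmul a m n \<omega>)
  then show ?case
    using gpart_mult[of "\<omega> Y" "n + y - 1" a m]
    by (simp add: form_apply[OF assms(2)] gpart_ksign algebra_simps)
qed

lemma one_form_closed:
  "one_form A n \<omega> \<Longrightarrow> Y \<in> derivations A y \<Longrightarrow> \<omega> Y \<in> carrier A"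
  using one_form_gpart gpart_carrier by blast

lemma form_sign_eq_lmul:
  assumes "one_form A n \<omega>"
  shows "form_sign A i \<omega> = form_lmul A 0 (ksign A i \<one>) n \<omega>"
proof (rule form_eqI)
  fix y Y assume Y: "Y \<in> derivations A y"
  show "form_sign A i \<omega> Y = form_lmul A 0 (ksign A i \<one>) n \<omega> Y"
    using one_form_closed[OF assms Y] by (simp add: form_apply[OF Y] ksign_def r_minus)
qed simp_all

lemma one_form_sign:
  assumes "one_form A n \<omega>"
  shows "one_form A n (form_sign A i \<omega>)"
  using one_form.lmul[OF gpart_ksign[OF gpart_one] assms, of i]
  by (simp add: form_sign_eq_lmul[OF assms])

lemma form_rmul_eq:
  assumes "one_form A n \<omega>" "a \<in> carrier A"
  shows "form_rmul A \<omega> a = form_sign A (m * n) (form_lmul A m a n \<omega>)"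
proof (rule form_eqI)
  fix y Y assume Y: "Y \<in> derivations A y"
  show "form_rmul A \<omega> a Y = form_sign A (m * n) (form_lmul A m a n \<omega>) Y"
    using one_form_closed[OF assms(1) Y] assms(2) by (simp add: form_apply[OF Y] ksign_def)
qed simp_all

lemma one_form_rmul:
  assumes "one_form A n \<omega>" "a \<in> gpart A m"
  shows "one_form A (n + m) (form_rmul A \<omega> a)"
  using one_form_sign[OF one_form.lmul[OF assms(2,1)]]
  by (simp add: form_rmul_eq[OF assms(1) gpart_carrier[OF assms(2)], of m] add.commute)

lemma ext_d_graph_one_form: "ext_d_graph A n \<omega> \<Theta> \<Longrightarrow> one_form A n \<omega>"
  by (induction rule: ext_d_graph.induct) (auto intro: one_form.intros)

lemma ext_d_graph_exists: "one_form A n \<omega> \<Longrightarrow> \<exists>\<Theta>. ext_d_graph A n \<omega> \<Theta>"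
  by (induction rule: one_form.induct) (blast intro: ext_d_graph.intros)+

lemma ext_d_graph_extensional:
  assumes "ext_d_graph A n \<omega> \<Theta>"
  shows "\<Theta> x \<in> extensional (derivations A x)"
    and "X \<in> derivations A x \<Longrightarrow> \<Theta> x X \<in> extensional (vector_fields A)"
  using assms
  by (induction rule: ext_d_graph.induct) (simp_all add: form2_zero_def form2_add_def)

lemma ext_d_graph_apply:
  assumes "ext_d_graph A n \<omega> \<Theta>" and X: "X \<in> derivations A x" and Y: "Y \<in> derivations A y"
  shows "\<Theta> x X Y = ksign A (x * y + x)
    (X (\<omega> Y) \<ominus> ksign A (x * y) (Y (\<omega> X)) \<ominus> \<omega> (graded_commutator A x y X Y))"
  using assms(1)
proof (induction rule: ext_d_graph.induct)
  note [simp] = derivation_closed[OF X] derivation_closed[OF Y]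
  note XY = commutator_derivation[OF X Y]
  {
    case (d \<xi> l)
    have "graded_commutator A x y X Y \<xi> = X (Y \<xi>) \<ominus> ksign A (x * y) (Y (X \<xi>))"
      using gpart_carrier[OF d] by (simp add: graded_commutator_def)
    then show ?case
      using X vector_fieldsI[OF Y] gpart_carrier[OF d]
      by (simp add: form2_zero_def form_apply[OF X] form_apply[OF Y] form_apply[OF XY]
          minus_eq r_neg, simp add: ksign_def)
  next
    case (add n \<omega> \<Theta> \<theta> \<Psi>)
    show ?case
      using X
      by (simp add: form2_add_def form_apply[OF X] form_apply[OF Y] form_apply[OF XY] add.IH
          X Y XY derivation_add[OF X] derivation_add[OF Y]
          one_form_closed[OF ext_d_graph_one_form[OF add(1)] X]
          one_form_closed[OF ext_d_graph_one_form[OF add(1)] Y]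
          one_form_closed[OF ext_d_graph_one_form[OF add(1)] XY]
          one_form_closed[OF ext_d_graph_one_form[OF add(2)] X]
          one_form_closed[OF ext_d_graph_one_form[OF add(2)] Y]
          one_form_closed[OF ext_d_graph_one_form[OF add(2)] XY]
          ksign_def minus_eq minus_add a_ac)
  next
    case (lmul a m n \<omega> \<Theta>)
    note \<omega> = ext_d_graph_one_form[OF lmul(2)]
    note [simp] = one_form_closed[OF \<omega> X] one_form_closed[OF \<omega> Y] one_form_closed[OF \<omega> XY]
      gpart_carrier[OF lmul(1)]
    have comm: "Y a \<otimes> \<omega> X = ksign A ((m + y) * (n + x - 1)) (\<omega> X \<otimes> Y a)"
      by (rule graded_comm[OF derivation_gpart[OF Y lmul(1)] one_form_gpart[OF \<omega> X]])
    have XY_a: "X (\<omega> Y \<otimes> a) = X (\<omega> Y) \<otimes> a \<oplus> ksign A (x * (n + y - 1)) (\<omega> Y \<otimes> X a)"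
      by (rule derivation_mult[OF X one_form_gpart[OF \<omega> Y]]) simp
    have YX_a: "Y (\<omega> X \<otimes> a) = Y (\<omega> X) \<otimes> a \<oplus> ksign A (y * (n + x - 1)) (\<omega> X \<otimes> Y a)"
      by (rule derivation_mult[OF Y one_form_gpart[OF \<omega> X]]) simp
    show ?case
      by (cases "even x"; cases "even y"; cases "even m"; cases "even n")
        (simp_all add: X form2_add_def form2_sign_def form2_lmul_def wedge_def form_apply[OF X]
          form_apply[OF Y] form_apply[OF XY] lmul.IH derivation_ksign[OF X] derivation_ksign[OF Y]
          comm XY_a YX_a, simp_all add: ksign_def derivation_neg[OF X] derivation_neg[OF Y]
          XY_a YX_a minus_eq l_distr r_distr l_minus r_minus minus_add a_ac)
  }
qed

lemma ext_d_eq: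
  assumes "ext_d_graph A n \<omega> \<Theta>"
  shows "ext_d A n \<omega> = \<Theta>"
  unfolding ext_d_def
proof (rule the_equality[of "ext_d_graph A n \<omega>", OF assms])
  fix \<Psi> assume \<Psi>: "ext_d_graph A n \<omega> \<Psi>"
  show "\<Psi> = \<Theta>"
  proof
    fix x
    show "\<Psi> x = \<Theta> x"
    proof (rule extensionalityI[OF ext_d_graph_extensional(1)[OF \<Psi>]
          ext_d_graph_extensional(1)[OF assms]])
      fix X assume X: "X \<in> derivations A x"
      show "\<Psi> x X = \<Theta> x X"
        using ext_d_graph_extensional(2)[OF \<Psi> X] ext_d_graph_extensional(2)[OF assms X]
        by (rule form_eqI) (simp add: ext_d_graph_apply[OF \<Psi> X] ext_d_graph_apply[OF assms X])
    qed
  qed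
qed

context
  fixes Q :: "'a vf"
  assumes Q: "Q \<in> derivations A 1"
begin

lemma lie_vf_derivation: "Y \<in> derivations A y \<Longrightarrow> lie_vf A Q y Y \<in> derivations A (1 + y)"
  unfolding lie_vf_def by (rule commutator_derivation[OF Q])

lemma lie_form_extensional [simp]: "lie_form A Q n \<omega> \<in> extensional (vector_fields A)"
  by (simp add: lie_form_def)

lemma lie_form_apply:
  assumes \<omega>: "one_form A n \<omega>" and Y: "Y \<in> derivations A y"
  shows "lie_form A Q n \<omega> Y = ksign A (y + 1) (Q (\<omega> Y) \<ominus> \<omega> (lie_vf A Q y Y))"
proof -
  obtain \<Theta> where \<Theta>: "ext_d_graph A n \<omega> \<Theta>"
    using ext_d_graph_exists[OF \<omega>] by blast
  have cancel: "q \<oplus> (r \<oplus> (\<ominus> q \<oplus> s)) = r \<oplus> s" "q \<oplus> (r \<oplus> (s \<oplus> \<ominus> q)) = r \<oplus> s"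
    if "q \<in> carrier A" "r \<in> carrier A" "s \<in> carrier A" for q r s
  proof -
    have "(q \<oplus> \<ominus> q) \<oplus> (r \<oplus> s) = r \<oplus> s"
      using that by (simp add: r_neg)
    then show "q \<oplus> (r \<oplus> (\<ominus> q \<oplus> s)) = r \<oplus> s" "q \<oplus> (r \<oplus> (s \<oplus> \<ominus> q)) = r \<oplus> s"
      using that by (simp_all only: a_ac a_inv_closed a_closed)
  qed
  note [simp] = one_form_closed[OF \<omega> Y] one_form_closed[OF \<omega> Q]
    one_form_closed[OF \<omega> commutator_derivation[OF Q Y]]
    derivation_closed[OF Q] derivation_closed[OF Y]
  show ?thesis
    by (simp add: lie_form_def form_apply[OF Y] ext_d_eq[OF \<Theta>] ext_d_graph_apply[OF \<Theta> Q Y]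
        lie_vf_def, simp add: ksign_def minus_eq minus_add a_ac cancel r_neg1 r_neg2)
qed

lemma lie_form_d:
  assumes \<xi>: "\<xi> \<in> gpart A l"
  shows "lie_form A Q (l + 1) (d_fun A \<xi>) = form_sign A 1 (d_fun A (Q \<xi>))"
proof (rule form_eqI)
  fix y Y assume Y: "Y \<in> derivations A y"
  have [simp]: "\<xi> \<in> carrier A" using \<xi> by (rule gpart_carrier)
  note [simp] = derivation_closed[OF Q] derivation_closed[OF Y]
  have "lie_vf A Q y Y \<xi> = Q (Y \<xi>) \<ominus> ksign A y (Y (Q \<xi>))"
    by (simp add: lie_vf_def graded_commutator_def)
  then show "lie_form A Q (l + 1) (d_fun A \<xi>) Y = form_sign A 1 (d_fun A (Q \<xi>)) Y"
    by (simp add: lie_form_apply[OF one_form.d[OF \<xi>] Y] form_apply[OF Y]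
        form_apply[OF lie_vf_derivation[OF Y]],
        simp add: ksign_def minus_eq minus_add r_neg1 r_neg2)
qed simp_all

lemma lie_form_add:
  assumes \<omega>: "one_form A n \<omega>" and \<theta>: "one_form A n \<theta>"
  shows "lie_form A Q n (form_add A \<omega> \<theta>) = form_add A (lie_form A Q n \<omega>) (lie_form A Q n \<theta>)"
proof (rule form_eqI)
  fix y Y assume Y: "Y \<in> derivations A y"
  note Z = lie_vf_derivation[OF Y]
  note [simp] = one_form_closed[OF \<omega> Y] one_form_closed[OF \<theta> Y]
    one_form_closed[OF \<omega> Z] one_form_closed[OF \<theta> Z] derivation_closed[OF Q]
  show "lie_form A Q n (form_add A \<omega> \<theta>) Y =
      form_add A (lie_form A Q n \<omega>) (lie_form A Q n \<theta>) Y"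
    by (simp add: lie_form_apply[OF \<omega> Y] lie_form_apply[OF \<theta> Y]
        lie_form_apply[OF one_form.add[OF \<omega> \<theta>] Y] form_apply[OF Y] form_apply[OF Z]
        derivation_add[OF Q], simp add: ksign_def minus_eq minus_add a_ac)
qed simp_all

lemma lie_form_lmul:
  assumes a: "a \<in> gpart A m" and \<omega>: "one_form A n \<omega>"
  shows "lie_form A Q (m + n) (form_lmul A m a n \<omega>) =
    form_add A (form_lmul A (m + 1) (Q a) n \<omega>)
      (form_sign A m (form_lmul A m a (n + 1) (lie_form A Q n \<omega>)))"
proof (rule form_eqI)
  fix y Y assume Y: "Y \<in> derivations A y"
  note Z = lie_vf_derivation[OF Y]
  note [simp] = one_form_closed[OF \<omega> Y] one_form_closed[OF \<omega> Z] derivation_closed[OF Q]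
    gpart_carrier[OF a]
  have Qa: "Q (\<omega> Y \<otimes> a) = Q (\<omega> Y) \<otimes> a \<oplus> ksign A (1 * (n + y - 1)) (\<omega> Y \<otimes> Q a)"
    by (rule derivation_mult[OF Q one_form_gpart[OF \<omega> Y]]) simp
  show "lie_form A Q (m + n) (form_lmul A m a n \<omega>) Y =
    form_add A (form_lmul A (m + 1) (Q a) n \<omega>)
      (form_sign A m (form_lmul A m a (n + 1) (lie_form A Q n \<omega>))) Y"
    by (cases "even y"; cases "even m"; cases "even n")
      (simp_all add: lie_form_apply[OF \<omega> Y] lie_form_apply[OF one_form.lmul[OF a \<omega>] Y]
        form_apply[OF Y] form_apply[OF Z] derivation_ksign[OF Q] Qa,
       simp_all add: ksign_def minus_eq l_distr l_minus r_minus minus_add a_ac)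
qed simp_all

lemma lie_form_one_form: "one_form A n \<omega> \<Longrightarrow> one_form A (n + 1) (lie_form A Q n \<omega>)"
proof (induction rule: one_form.induct)
  case (d \<xi> l)
  then show ?case
    using one_form_sign[OF one_form.d[OF derivation_gpart[OF Q d]]] by (simp add: lie_form_d)
next
  case (add n \<omega> \<theta>)
  then show ?case by (simp add: lie_form_add one_form.add)
next
  case (lmul a m n \<omega>)
  have "one_form A (m + n + 1) (form_lmul A (m + 1) (Q a) n \<omega>)"
    using one_form.lmul[OF derivation_gpart[OF Q lmul(1)] lmul(2)] by (simp add: add_ac)
  moreover have "one_form A (m + n + 1)
      (form_sign A m (form_lmul A m a (n + 1) (lie_form A Q n \<omega>)))"
    using one_form_sign[OF one_form.lmul[OF lmul(1,3)]] by (simp add: add_ac)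
  ultimately show ?case
    using lmul by (simp add: lie_form_lmul one_form.add)
qed

end

end


section \<open>Poisson brackets\<close>

locale graded_poisson_algebra = graded_algebra +
  fixes k :: int and br :: "'a \<Rightarrow> 'a \<Rightarrow> 'a"
  assumes poisson: "poisson_bracket A k br"
begin

lemma bracketD:
  shows bracket_closed: "a \<in> carrier A \<Longrightarrow> b \<in> carrier A \<Longrightarrow> br a b \<in> carrier A"
    and bracket_add_right: "a \<in> carrier A \<Longrightarrow> b \<in> carrier A \<Longrightarrow> c \<in> carrier A \<Longrightarrow>
      br a (b \<oplus> c) = br a b \<oplus> br a c"
    and bracket_smult_right: "a \<in> carrier A \<Longrightarrow> b \<in> carrier A \<Longrightarrow> br a (r \<odot> b) = r \<odot> br a b"
    and bracket_gpart: "a \<in> gpart A p \<Longrightarrow> b \<in> gpart A q \<Longrightarrow> br a b \<in> gpart A (p + q + k)"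
    and bracket_antisym: "a \<in> gpart A p \<Longrightarrow> b \<in> gpart A q \<Longrightarrow>
      br a b = \<ominus> (ksign A ((p + k) * (q + k)) (br b a))"
    and bracket_mult: "a \<in> gpart A p \<Longrightarrow> b \<in> gpart A q \<Longrightarrow> c \<in> gpart A s \<Longrightarrow>
      br a (b \<otimes> c) = (br a b \<otimes> c) \<oplus> ksign A ((p + k) * q) (b \<otimes> br a c)"
proof -
  note * = poisson[unfolded poisson_bracket_def]
  show "a \<in> carrier A \<Longrightarrow> b \<in> carrier A \<Longrightarrow> br a b \<in> carrier A"
    using *[THEN conjunct1] by simp
  show "a \<in> carrier A \<Longrightarrow> b \<in> carrier A \<Longrightarrow> c \<in> carrier A \<Longrightarrow> br a (b \<oplus> c) = br a b \<oplus> br a c"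
    using *[THEN conjunct2, THEN conjunct1] by simp
  show "a \<in> carrier A \<Longrightarrow> b \<in> carrier A \<Longrightarrow> br a (r \<odot> b) = r \<odot> br a b"
    using *[THEN conjunct2, THEN conjunct2, THEN conjunct1] by simp
  show "a \<in> gpart A p \<Longrightarrow> b \<in> gpart A q \<Longrightarrow> br a b \<in> gpart A (p + q + k)"
    using *[THEN conjunct2, THEN conjunct2, THEN conjunct2, THEN conjunct1] by simp
  show "a \<in> gpart A p \<Longrightarrow> b \<in> gpart A q \<Longrightarrow> br a b = \<ominus> (ksign A ((p + k) * (q + k)) (br b a))"
    using *[THEN conjunct2, THEN conjunct2, THEN conjunct2, THEN conjunct2, THEN conjunct1]
    by blast
  show "a \<in> gpart A p \<Longrightarrow> b \<in> gpart A q \<Longrightarrow> c \<in> gpart A s \<Longrightarrow>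
      br a (b \<otimes> c) = (br a b \<otimes> c) \<oplus> ksign A ((p + k) * q) (b \<otimes> br a c)"
    using *[THEN conjunct2, THEN conjunct2, THEN conjunct2, THEN conjunct2, THEN conjunct2,
        THEN conjunct1] by blast
qed

definition hamiltonian :: "'a \<Rightarrow> 'a vf" where
  "hamiltonian \<xi> = (\<lambda>\<zeta>\<in>carrier A. br \<xi> \<zeta>)"

lemma hamiltonian_derivation:
  assumes \<xi>: "\<xi> \<in> gpart A l"
  shows "hamiltonian \<xi> \<in> derivations A (l + k)"
proof (rule derivationsI)
  note [simp] = gpart_carrier[OF \<xi>] bracket_closed
  fix n b c assume b: "b \<in> gpart A n" and c: "c \<in> carrier A"
  note [simp] = gpart_carrier[OF b]
  have "br \<xi> (b \<otimes> c) = (br \<xi> b \<otimes> c) \<oplus> ksign A ((l + k) * n) (b \<otimes> br \<xi> c)"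
    using c
  proof (induction rule: homogeneous_induct)
    case (homogeneous r c)
    then show ?case by (rule bracket_mult[OF \<xi> b])
  next
    case (add c d)
    then show ?case
      by (simp add: r_distr bracket_add_right ksign_add a_ac)
  qed
  then show "hamiltonian \<xi> (b \<otimes> c) =
      (hamiltonian \<xi> b \<otimes> c) \<oplus> ksign A ((l + k) * n) (b \<otimes> hamiltonian \<xi> c)"
    using c by (simp add: hamiltonian_def)
next
  fix n b assume "b \<in> gpart A n"
  then show "hamiltonian \<xi> b \<in> gpart A (n + (l + k))"
    using bracket_gpart[OF \<xi>, of b n] by (simp add: hamiltonian_def gpart_carrier add_ac)
qed (use gpart_carrier[OF \<xi>] in \<open>auto simp: hamiltonian_def bracket_closed bracket_add_right
    bracket_smult_right\<close>)

lemma pi_sharp_graph_one_form: "pi_sharp_graph A k br n \<omega> Y \<Longrightarrow> one_form A n \<omega>"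
  by (induction rule: pi_sharp_graph.induct) (auto intro: one_form.intros one_form_rmul)

lemma pi_sharp_graph_exists: "one_form A n \<omega> \<Longrightarrow> \<exists>Y. pi_sharp_graph A k br n \<omega> Y"
  by (induction rule: one_form.induct) (blast intro: pi_sharp_graph.intros)+

lemma pi_sharp_graph_derivation:
  "pi_sharp_graph A k br n \<omega> Y \<Longrightarrow> Y \<in> derivations A (n - 1 + k)"
proof (induction rule: pi_sharp_graph.induct)
  case (d \<xi> l)
  then show ?case
    using hamiltonian_derivation[OF d] by (simp only: hamiltonian_def add_diff_cancel_right')
next
  case (add n \<omega> Y \<theta> Z)
  then show ?case by (simp add: vf_add_derivation)
next
  case (lmul a m n \<omega> Y)
  then show ?case
    using vf_sign_derivation[OF vf_lmul_derivation[OF lmul(1,3)]] by (simp add: algebra_simps)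
next
  case (rmul a m n \<omega> Y)
  then show ?case
    using vf_sign_derivation[OF vf_sign_derivation[OF vf_lmul_derivation[OF rmul(1,3)]]]
    by (simp add: vf_rmul_def algebra_simps)
qed

lemma pi_sharp_graph_apply:
  assumes "pi_sharp_graph A k br n \<omega> Y" and \<zeta>: "\<zeta> \<in> gpart A z"
  shows "Y \<zeta> = ksign A ((n - 1 + k) * (z + k) + 1) (\<omega> (hamiltonian \<zeta>))"
  using assms(1)
proof (induction rule: pi_sharp_graph.induct)
  note [simp] = gpart_carrier[OF \<zeta>]
  note H = hamiltonian_derivation[OF \<zeta>]
  {
    case (d \<xi> l)
    then show ?case
      using bracket_antisym[OF d \<zeta>] gpart_carrier[OF d]
      by (simp add: form_apply[OF H], simp add: hamiltonian_def ksign_def bracket_closed)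
  next
    case (add n \<omega> Y \<theta> Z)
    then show ?case
      by (simp add: form_apply[OF H] vf_add_def ksign_add
          one_form_closed[OF pi_sharp_graph_one_form[OF add(1)] H]
          one_form_closed[OF pi_sharp_graph_one_form[OF add(2)] H] add.IH)
  next
    case (lmul a m n \<omega> Y)
    note \<omega> = pi_sharp_graph_one_form[OF lmul(2)]
    note [simp] = gpart_carrier[OF lmul(1)] one_form_closed[OF \<omega> H]
    have comm: "a \<otimes> \<omega> (hamiltonian \<zeta>) =
        ksign A (m * (n + (z + k) - 1)) (\<omega> (hamiltonian \<zeta>) \<otimes> a)"
      by (rule graded_comm[OF lmul(1) one_form_gpart[OF \<omega> H]])
    show ?case
      by (cases "even z"; cases "even m"; cases "even n"; cases "even k")
        (simp_all add: form_apply[OF H] vf_sign_def vf_lmul_def lmul.IH,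
         simp_all add: ksign_def comm r_minus)
  next
    case (rmul a m n \<omega> Y)
    note \<omega> = pi_sharp_graph_one_form[OF rmul(2)]
    note [simp] = gpart_carrier[OF rmul(1)] one_form_closed[OF \<omega> H]
    have comm: "a \<otimes> \<omega> (hamiltonian \<zeta>) =
        ksign A (m * (n + (z + k) - 1)) (\<omega> (hamiltonian \<zeta>) \<otimes> a)"
      by (rule graded_comm[OF rmul(1) one_form_gpart[OF \<omega> H]])
    show ?case
      by (cases "even z"; cases "even m"; cases "even n"; cases "even k")
        (simp_all add: form_apply[OF H] vf_sign_def vf_lmul_def vf_rmul_def rmul.IH,
         simp_all add: ksign_def comm r_minus)
  }
qed

lemma pi_sharp_eq:
  assumes "pi_sharp_graph A k br n \<omega> Y"
  shows "pi_sharp A k br n \<omega> = Y"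
  unfolding pi_sharp_def
proof (rule the_equality[of "pi_sharp_graph A k br n \<omega>", OF assms])
  fix Z assume Z: "pi_sharp_graph A k br n \<omega> Z"
  note DZ = pi_sharp_graph_derivation[OF Z] and DY = pi_sharp_graph_derivation[OF assms]
  show "Z = Y"
    by (rule derivation_eqI[OF DZ DY])
      (simp add: pi_sharp_graph_apply[OF Z] pi_sharp_graph_apply[OF assms])
qed

lemma pi_sharp_graph_pi_sharp:
  "one_form A n \<omega> \<Longrightarrow> pi_sharp_graph A k br n \<omega> (pi_sharp A k br n \<omega>)"
  using pi_sharp_graph_exists pi_sharp_eq by metis

lemma pi_sharp_graph_sign:
  assumes "pi_sharp_graph A k br n \<omega> Y"
  shows "pi_sharp_graph A k br n (form_sign A i \<omega>) (vf_sign A i Y)"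
proof -
  note DY = pi_sharp_graph_derivation[OF assms]
  have "vf_sign A i Y \<zeta> = vf_sign A 0 (vf_lmul A (ksign A i \<one>) Y) \<zeta>" for \<zeta>
    using derivation_closed[OF DY, of \<zeta>]
    by (cases "\<zeta> \<in> carrier A") (simp_all add: vf_sign_def vf_lmul_def ksign_def l_minus)
  then have "vf_sign A i Y = vf_sign A 0 (vf_lmul A (ksign A i \<one>) Y)"
    by blast
  then show ?thesis
    using pi_sharp_graph.lmul[OF gpart_ksign[OF gpart_one] assms, of i]
    by (simp add: form_sign_eq_lmul[OF pi_sharp_graph_one_form[OF assms]])
qed

context
  fixes Q :: "'a vf"
  assumes Q: "Q \<in> derivations A 1"
begin

lemma lie_vf_hamiltonian:
  assumes \<xi>: "\<xi> \<in> gpart A l" and \<zeta>: "\<zeta> \<in> carrier A"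
  shows "lie_vf A Q (l + k) (hamiltonian \<xi>) \<zeta> =
    Q (br \<xi> \<zeta>) \<ominus> ksign A (l + k) (br \<xi> (Q \<zeta>))"
  using \<zeta> derivation_closed[OF Q \<zeta>]
  by (simp add: lie_vf_def graded_commutator_def hamiltonian_def)

lemma lie_vf_hamiltonian_PQ:
  assumes PQ: "PQ_compatible A Q k br" and \<xi>: "\<xi> \<in> gpart A l"
  shows "lie_vf A Q (l + k) (hamiltonian \<xi>) = hamiltonian (Q \<xi>)"
proof -
  note H = hamiltonian_derivation[OF \<xi>]
  note L = lie_vf_derivation[OF Q H]
    and R = hamiltonian_derivation[OF derivation_gpart[OF Q \<xi>]]
  show ?thesis
  proof (rule derivation_eqI[OF L R])
    fix n \<zeta> assume \<zeta>: "\<zeta> \<in> gpart A n"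
    note [simp] = gpart_carrier[OF \<xi>] gpart_carrier[OF \<zeta>] derivation_closed[OF Q] bracket_closed
    have "Q (br \<xi> \<zeta>) = br (Q \<xi>) \<zeta> \<oplus> ksign A (l + k) (br \<xi> (Q \<zeta>))"
      using PQ \<xi> \<zeta> unfolding PQ_compatible_def by blast
    then show "lie_vf A Q (l + k) (hamiltonian \<xi>) \<zeta> = hamiltonian (Q \<xi>) \<zeta>"
      by (simp add: lie_vf_hamiltonian[OF \<xi>], simp add: hamiltonian_def minus_eq a_assoc r_neg)
  qed
qed

lemma sign_lie_vf_add:
  assumes Y: "Y \<in> derivations A j" and Z: "Z \<in> derivations A j"
  shows "vf_sign A 1 (lie_vf A Q j (vf_add A Y Z)) =
    vf_add A (vf_sign A 1 (lie_vf A Q j Y)) (vf_sign A 1 (lie_vf A Q j Z))"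
proof
  note [simp] = derivation_closed[OF Q] derivation_closed[OF Y] derivation_closed[OF Z]
  show "vf_sign A 1 (lie_vf A Q j (vf_add A Y Z)) \<zeta> =
    vf_add A (vf_sign A 1 (lie_vf A Q j Y)) (vf_sign A 1 (lie_vf A Q j Z)) \<zeta>" for \<zeta>
    by (cases "\<zeta> \<in> carrier A")
      (simp_all add: vf_sign_def vf_add_def lie_vf_def graded_commutator_def derivation_add[OF Q]
        ksign_def minus_eq minus_add a_ac)
qed

lemma sign_lie_vf_lmul:
  assumes a: "a \<in> gpart A m" and Y: "Y \<in> derivations A j"
  shows "vf_sign A 1 (lie_vf A Q (m + j) (vf_sign A m (vf_lmul A a Y))) =
    vf_add A (vf_sign A (m + 1) (vf_lmul A (Q a) Y))
      (vf_sign A m (vf_sign A m (vf_lmul A a (vf_sign A 1 (lie_vf A Q j Y)))))"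
proof
  fix \<zeta>
  note [simp] = derivation_closed[OF Q] derivation_closed[OF Y] gpart_carrier[OF a]
  have Qa: "Q (a \<otimes> Y \<zeta>) = (Q a \<otimes> Y \<zeta>) \<oplus> ksign A (1 * m) (a \<otimes> Q (Y \<zeta>))"
    if "\<zeta> \<in> carrier A"
    using that by (intro derivation_mult[OF Q a]) simp
  show "vf_sign A 1 (lie_vf A Q (m + j) (vf_sign A m (vf_lmul A a Y))) \<zeta> =
    vf_add A (vf_sign A (m + 1) (vf_lmul A (Q a) Y))
      (vf_sign A m (vf_sign A m (vf_lmul A a (vf_sign A 1 (lie_vf A Q j Y))))) \<zeta>"
    by (cases "\<zeta> \<in> carrier A"; cases "even m"; cases "even j")
      (simp_all add: vf_sign_def vf_lmul_def vf_add_def lie_vf_def graded_commutator_def ksign_def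
        derivation_neg[OF Q] Qa minus_eq minus_add l_minus r_minus r_distr a_ac)
qed

lemma pi_sharp_graph_lie:
  assumes PQ: "PQ_compatible A Q k br" and "one_form A n \<omega>"
  shows "\<exists>Y. pi_sharp_graph A k br n \<omega> Y \<and>
    pi_sharp_graph A k br (n + 1) (lie_form A Q n \<omega>) (vf_sign A 1 (lie_vf A Q (n - 1 + k) Y))"
  using assms(2)
proof (induction rule: one_form.induct)
  case (d \<xi> l)
  have "pi_sharp_graph A k br (l + 1 + 1) (d_fun A (Q \<xi>)) (hamiltonian (Q \<xi>))"
    unfolding hamiltonian_def by (rule pi_sharp_graph.d[OF derivation_gpart[OF Q d]])
  from pi_sharp_graph_sign[OF this, of 1]
  have "pi_sharp_graph A k br (l + 1 + 1) (lie_form A Q (l + 1) (d_fun A \<xi>))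
      (vf_sign A 1 (lie_vf A Q (l + 1 - 1 + k) (hamiltonian \<xi>)))"
    by (simp add: lie_form_d[OF Q d] lie_vf_hamiltonian_PQ[OF PQ d])
  moreover have "pi_sharp_graph A k br (l + 1) (d_fun A \<xi>) (hamiltonian \<xi>)"
    unfolding hamiltonian_def by (rule pi_sharp_graph.d[OF d])
  ultimately show ?case by blast
next
  case (add n \<omega> \<theta>)
  then obtain Y Z where Y: "pi_sharp_graph A k br n \<omega> Y" "pi_sharp_graph A k br (n + 1)
      (lie_form A Q n \<omega>) (vf_sign A 1 (lie_vf A Q (n - 1 + k) Y))"
    and Z: "pi_sharp_graph A k br n \<theta> Z" "pi_sharp_graph A k br (n + 1)
      (lie_form A Q n \<theta>) (vf_sign A 1 (lie_vf A Q (n - 1 + k) Z))"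
    by blast
  then show ?case
    using pi_sharp_graph.add[OF Y(1) Z(1)] pi_sharp_graph.add[OF Y(2) Z(2)]
      sign_lie_vf_add[OF pi_sharp_graph_derivation[OF Y(1)] pi_sharp_graph_derivation[OF Z(1)]]
    by (auto simp: lie_form_add[OF Q add(1,2)])
next
  case (lmul a m n \<omega>)
  then obtain Y where Y: "pi_sharp_graph A k br n \<omega> Y" "pi_sharp_graph A k br (n + 1)
      (lie_form A Q n \<omega>) (vf_sign A 1 (lie_vf A Q (n - 1 + k) Y))"
    by blast
  have *: "pi_sharp_graph A k br (m + n + 1) (form_lmul A (m + 1) (Q a) n \<omega>)
      (vf_sign A (m + 1) (vf_lmul A (Q a) Y))"
    using pi_sharp_graph.lmul[OF derivation_gpart[OF Q lmul(1)] Y(1)] by (simp add: add_ac)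
  have **: "pi_sharp_graph A k br (m + n + 1)
      (form_sign A m (form_lmul A m a (n + 1) (lie_form A Q n \<omega>)))
      (vf_sign A m (vf_sign A m (vf_lmul A a (vf_sign A 1 (lie_vf A Q (n - 1 + k) Y)))))"
    using pi_sharp_graph_sign[OF pi_sharp_graph.lmul[OF lmul(1) Y(2)], of m]
    by (simp add: add_ac)
  have deg: "m + n - 1 + k = m + (n - 1 + k)" by simp
  show ?case
    using pi_sharp_graph.add[OF * **] pi_sharp_graph.lmul[OF lmul(1) Y(1)]
    unfolding lie_form_lmul[OF Q lmul(1,2)] deg
      sign_lie_vf_lmul[OF lmul(1) pi_sharp_graph_derivation[OF Y(1)], symmetric]
    by blast
qed

lemma PQ_compatible_iff:
  "PQ_compatible A Q k br \<longleftrightarrow> (\<forall>p \<omega>. one_form A p \<omega> \<longrightarrow>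
     pi_sharp A k br (p + 1) (lie_form A Q p \<omega>) =
     vf_sign A 1 (lie_vf A Q (p - 1 + k) (pi_sharp A k br p \<omega>)))"
proof
  assume "PQ_compatible A Q k br"
  then show "\<forall>p \<omega>. one_form A p \<omega> \<longrightarrow>
     pi_sharp A k br (p + 1) (lie_form A Q p \<omega>) =
     vf_sign A 1 (lie_vf A Q (p - 1 + k) (pi_sharp A k br p \<omega>))"
    using pi_sharp_graph_lie pi_sharp_eq by blast
next
  assume comm: "\<forall>p \<omega>. one_form A p \<omega> \<longrightarrow>
     pi_sharp A k br (p + 1) (lie_form A Q p \<omega>) =
     vf_sign A 1 (lie_vf A Q (p - 1 + k) (pi_sharp A k br p \<omega>))"
  show "PQ_compatible A Q k br"
    unfolding PQ_compatible_def
  proof (intro allI ballI)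
    fix p q a b assume a: "a \<in> gpart A p" and b: "b \<in> gpart A q"
    note [simp] = gpart_carrier[OF a] gpart_carrier[OF b] derivation_closed[OF Q] bracket_closed
    have pi: "pi_sharp A k br (l + 1) (d_fun A \<xi>) = hamiltonian \<xi>" if "\<xi> \<in> gpart A l" for \<xi> l
      unfolding hamiltonian_def by (rule pi_sharp_eq[OF pi_sharp_graph.d[OF that]])
    have "pi_sharp_graph A k br (p + 1 + 1) (d_fun A (Q a)) (hamiltonian (Q a))"
      unfolding hamiltonian_def by (rule pi_sharp_graph.d[OF derivation_gpart[OF Q a]])
    from pi_sharp_eq[OF pi_sharp_graph_sign[OF this, of 1]]
    have "vf_sign A 1 (hamiltonian (Q a)) = vf_sign A 1 (lie_vf A Q (p + k) (hamiltonian a))"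
      using comm[rule_format, OF one_form.d[OF a]] by (simp add: lie_form_d[OF Q a] pi[OF a])
    from fun_cong[OF this, of b]
    have "\<ominus> br (Q a) b = \<ominus> (Q (br a b) \<ominus> ksign A (p + k) (br a (Q b)))"
      by (simp add: vf_sign_def lie_vf_hamiltonian[OF a] ksign_def[of A 1])
        (simp add: hamiltonian_def)
    then have "br (Q a) b = Q (br a b) \<ominus> ksign A (p + k) (br a (Q b))"
      by (metis a_inv_closed minus_minus bracket_closed derivation_closed[OF Q] minus_closed
          ksign_closed gpart_carrier a b)
    then show "Q (br a b) = br (Q a) b \<oplus> ksign A (p + k) (br a (Q b))"
      by (simp add: minus_eq a_assoc l_neg)
  qed
qed

lemma graded_map_pi_sharp:
  "graded_map k (forms_module A D) (vf_module A k D') (pi_sharp A k br)"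
  unfolding graded_map_def forms_module_def vf_module_def
  using pi_sharp_graph_derivation[OF pi_sharp_graph_pi_sharp]
    pi_sharp_eq[OF pi_sharp_graph.add[OF pi_sharp_graph_pi_sharp pi_sharp_graph_pi_sharp]]
  by simp

lemma left_dg_anti_morphism_pi_sharp_iff:
  "left_dg_anti_morphism A k (forms_module A (lie_form A Q)) (vf_module A k (lie_vf A Q))
     (pi_sharp A k br) \<longleftrightarrow>
   (\<forall>p \<omega>. one_form A p \<omega> \<longrightarrow>
     pi_sharp A k br (p + 1) (lie_form A Q p \<omega>) =
     vf_sign A 1 (lie_vf A Q (p - 1 + k) (pi_sharp A k br p \<omega>)))"
  using graded_map_pi_sharp[of "lie_form A Q" "lie_vf A Q"]
    pi_sharp_eq[OF pi_sharp_graph.lmul[OF _ pi_sharp_graph_pi_sharp]]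
  by (simp add: left_dg_anti_morphism_def forms_module_def vf_module_def)

lemma vf_sign_cancel:
  assumes "Y \<in> derivations A j"
  shows "vf_sign A i (vf_sign A i Y) = Y"
proof (rule extensionalityI[of _ "carrier A"])
  show "vf_sign A i (vf_sign A i Y) a = Y a" if "a \<in> carrier A" for a
    using that derivation_closed[OF assms] by (simp add: vf_sign_def ksign_def)
qed (simp_all add: vf_sign_def derivation_extensional[OF assms])

lemma right_dg_morphism_pi_sharp_iff:
  "right_dg_morphism A k (forms_module A (\<lambda>p \<omega>. form_sign A 1 (lie_form A Q p \<omega>)))
     (vf_module A k (lie_vf A Q)) (pi_sharp A k br) \<longleftrightarrow>
   (\<forall>p \<omega>. one_form A p \<omega> \<longrightarrow>
     pi_sharp A k br (p + 1) (lie_form A Q p \<omega>) =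
     vf_sign A 1 (lie_vf A Q (p - 1 + k) (pi_sharp A k br p \<omega>)))"
proof -
  have "pi_sharp A k br (p + 1) (form_sign A 1 (lie_form A Q p \<omega>)) =
      lie_vf A Q (p - 1 + k) (pi_sharp A k br p \<omega>) \<longleftrightarrow>
    pi_sharp A k br (p + 1) (lie_form A Q p \<omega>) =
      vf_sign A 1 (lie_vf A Q (p - 1 + k) (pi_sharp A k br p \<omega>))" if \<omega>: "one_form A p \<omega>" for p \<omega>
  proof -
    note G = pi_sharp_graph_pi_sharp[OF lie_form_one_form[OF Q \<omega>]]
    note L = lie_vf_derivation[OF Q pi_sharp_graph_derivation[OF pi_sharp_graph_pi_sharp[OF \<omega>]]]
    show ?thesis
      unfolding pi_sharp_eq[OF pi_sharp_graph_sign[OF G]]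
      using vf_sign_cancel[OF L] vf_sign_cancel[OF pi_sharp_graph_derivation[OF G]] by metis
  qed
  then show ?thesis
    using graded_map_pi_sharp[of "\<lambda>p \<omega>. form_sign A 1 (lie_form A Q p \<omega>)" "lie_vf A Q"]
      pi_sharp_eq[OF pi_sharp_graph.rmul[OF _ pi_sharp_graph_pi_sharp]]
    by (simp add: right_dg_morphism_def forms_module_def vf_module_def)
qed

end

end


section \<open>Global functions on a graded manifold\<close>

lemma C_k_on_const: "C_k_on n k S (\<lambda>x. c)"
proof (induction k arbitrary: c)
  case (Suc k)
  have "((\<lambda>t. c) has_real_derivative 0) (at (x i))" for x :: "nat \<Rightarrow> real" and i
    by simp
  then show ?case
    using Suc[of 0] by (auto intro!: exI[of _ "\<lambda>x. 0"])
qed simp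

lemma continuous_map_fun_upd_Euclidean_space:
  assumes "x \<in> topspace (Euclidean_space n)" "i < n"
  shows "continuous_map euclideanreal (Euclidean_space n) (\<lambda>t. x(i := t))"
proof -
  have "continuous_map euclideanreal euclideanreal (\<lambda>t. (x(i := t)) j)" for j
    by (cases "j = i") auto
  then show ?thesis
    using assms
    by (auto simp: Euclidean_space_def continuous_map_in_subtopology
        continuous_map_componentwise_UNIV)
qed

text \<open>
  Openness matters: the difference quotients in \<^const>\<open>C_k_on\<close> also involve values of \<open>f\<close> outside
  \<open>S\<close>, which are arbitrary when \<open>f\<close> is read in a chart through \<^const>\<open>inv_into\<close>.
\<close>

lemma smooth_on_open_const:
  assumes S: "openin (Euclidean_space n) S" and f: "\<And>x. x \<in> S \<Longrightarrow> f x = c"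
  shows "smooth_on n S f"
proof -
  have cont: "continuous_map (subtopology (Euclidean_space n) S) euclideanreal f"
    by (rule continuous_map_eq[where f = "\<lambda>x. c"]) (auto simp: f)
  have deriv: "((\<lambda>t. f (x(i := t))) has_real_derivative 0) (at (x i))"
    if x: "x \<in> S" and i: "i < n" for x i
  proof -
    have "x \<in> topspace (Euclidean_space n)"
      using openin_subset[OF S] x by blast
    then have "openin euclideanreal {t \<in> topspace euclideanreal. x(i := t) \<in> S}"
      using continuous_map_fun_upd_Euclidean_space i S by (intro openin_continuous_map_preimage)
    then have "open {t. x(i := t) \<in> S}"
      by simp
    with DERIV_const show ?thesis
      by (rule has_field_derivative_transform_within_open) (use x f in auto)
  qed
  have "C_k_on n k S f" for k
  proof (cases k)
    case (Suc l)
    then show ?thesis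
      using cont deriv by (auto intro!: exI[of _ "\<lambda>x. 0"] simp: C_k_on_const)
  qed (simp add: cont)
  then show ?thesis
    by (simp add: smooth_on_def)
qed

lemma const_in_C_inf:
  assumes "smooth_manifold X n atlas"
  shows "(\<lambda>x\<in>topspace X. r) \<in> carrier (C_inf n atlas (topspace X))"
proof -
  have "smooth_on n (\<phi> ` (topspace X \<inter> V)) (\<lambda>y. (\<lambda>x\<in>topspace X. r) (inv_into V \<phi> y))"
    if "(V, \<phi>) \<in> atlas" for V \<phi>
  proof (rule smooth_on_open_const)
    have "is_chart X n (V, \<phi>)"
      using assms that by (auto simp: smooth_manifold_def)
    then have V: "V \<subseteq> topspace X" "openin (Euclidean_space n) (\<phi> ` V)"
      by (auto simp: is_chart_def openin_subset)
    then have *: "topspace X \<inter> V = V" by blast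
    show "openin (Euclidean_space n) (\<phi> ` (topspace X \<inter> V))"
      using V * by simp
    fix y assume "y \<in> \<phi> ` (topspace X \<inter> V)"
    then have "inv_into V \<phi> y \<in> topspace X"
      using V(1) inv_into_into[of y \<phi> V] unfolding * by auto
    then show "(\<lambda>x\<in>topspace X. r) (inv_into V \<phi> y) = r"
      by simp
  qed
  then show ?thesis
    by (auto simp: C_inf_def smooth_fun_def)
qed

lemma graded_algebra_global_functions:
  assumes "graded_manifold X n atlas ds F"
  shows "graded_algebra (global_functions X F)"
proof -
  define S where "S = sect F (topspace X)"
  define A where "A = global_functions X F"
  define K where "K = C_inf n atlas (topspace X)"
  have "smooth_manifold X n atlas" "sheaf_of_graded_algebras X n atlas F"
    using assms by (simp_all add: graded_manifold_def)
  then have const: "(\<lambda>x\<in>topspace X. r) \<in> carrier K" and alg: "graded_comm_algebra K S" for r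
    using const_in_C_inf by (auto simp: K_def S_def sheaf_of_graded_algebras_def)
  have A_simps [simp]: "carrier A = carrier S" "monoid.mult A = monoid.mult S" "one A = one S"
    "zero A = zero S" "add A = add S" "gpart A = gpart S"
    "r \<odot>\<^bsub>A\<^esub> a = (\<lambda>x\<in>topspace X. r) \<odot>\<^bsub>S\<^esub> a" for r a
    by (simp_all add: A_def S_def global_functions_def Let_def)
  have a_inv: "a_inv A = a_inv S"
    by (simp add: a_inv_def m_inv_def fun_eq_iff)
  have ksign: "ksign A = ksign S"
    by (simp add: ksign_def a_inv fun_eq_iff)
  have finsum: "finsum A = finsum S"
    by (simp add: finsum_def finprod_def fun_eq_iff)
  have ring: "ring S" and mod: "Module.module K S"
    and smult_mult: "\<forall>f\<in>carrier K. \<forall>a\<in>carrier S. \<forall>b\<in>carrier S.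
        f \<odot>\<^bsub>S\<^esub> (a \<otimes>\<^bsub>S\<^esub> b) = (f \<odot>\<^bsub>S\<^esub> a) \<otimes>\<^bsub>S\<^esub> b \<and>
        f \<odot>\<^bsub>S\<^esub> (a \<otimes>\<^bsub>S\<^esub> b) = a \<otimes>\<^bsub>S\<^esub> (f \<odot>\<^bsub>S\<^esub> b)"
    and sub: "\<forall>m. submodule (gpart S m) K S"
    and decomp: "\<forall>a\<in>carrier S. \<exists>!c. (\<forall>n. c n \<in> gpart S n) \<and> finite {n. c n \<noteq> \<zero>\<^bsub>S\<^esub>} \<and>
        a = finsum S c {n. c n \<noteq> \<zero>\<^bsub>S\<^esub>}"
    and one: "\<one>\<^bsub>S\<^esub> \<in> gpart S 0"
    and mult: "\<forall>l m. \<forall>a\<in>gpart S l. \<forall>b\<in>gpart S m.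
        a \<otimes>\<^bsub>S\<^esub> b \<in> gpart S (l + m) \<and> a \<otimes>\<^bsub>S\<^esub> b = ksign S (l * m) (b \<otimes>\<^bsub>S\<^esub> a)"
    using alg unfolding graded_comm_algebra_def by - (elim conjE, assumption)+
  interpret S: ring S by (rule ring)
  interpret M: Module.module K S by (rule mod)
  from sub have subgroup: "subgroup (gpart S m) (add_monoid S)" for m
    by (simp add: submodule_def)
  have "ring A"
  proof (rule ringI)
    show "abelian_group A"
      by (rule abelian_groupI) (auto simp: S.a_ac intro: S.l_neg S.a_inv_closed)
    show "Group.monoid A"
      by (rule monoidI) (auto simp: S.m_assoc)
  qed (auto simp: S.l_distr S.r_distr)
  moreover have "graded_algebra_axioms A"
  proof
    fix a r assume "a \<in> carrier A"
    then show "r \<odot>\<^bsub>A\<^esub> a \<in> carrier A"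
      using const by simp
  next
    fix a b r assume "a \<in> carrier A" "b \<in> carrier A"
    then have ab: "a \<in> carrier S" "b \<in> carrier S"
      by simp_all
    then show "r \<odot>\<^bsub>A\<^esub> (a \<oplus>\<^bsub>A\<^esub> b) = r \<odot>\<^bsub>A\<^esub> a \<oplus>\<^bsub>A\<^esub> r \<odot>\<^bsub>A\<^esub> b"
      using const[of r] by (simp add: M.smult_r_distr)
    show "r \<odot>\<^bsub>A\<^esub> (a \<otimes>\<^bsub>A\<^esub> b) = a \<otimes>\<^bsub>A\<^esub> (r \<odot>\<^bsub>A\<^esub> b)"
      using bspec[OF bspec[OF bspec[OF smult_mult const[of r]] ab(1)] ab(2)]
      unfolding A_simps by (rule conjunct2)
  next
    fix a m assume a: "a \<in> gpart A m"
    show "a \<in> carrier A"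
      using subgroup.subset[OF subgroup] a by auto
    show "\<ominus>\<^bsub>A\<^esub> a \<in> gpart A m"
      using subgroup.m_inv_closed[OF subgroup, of a m] a by (simp add: a_inv) (simp add: a_inv_def)
    fix b assume b: "b \<in> gpart A m"
    show "a \<oplus>\<^bsub>A\<^esub> b \<in> gpart A m"
      using subgroup.m_closed[OF subgroup] a b by simp
  next
    show "\<one>\<^bsub>A\<^esub> \<in> gpart A 0"
      using one by simp
  next
    fix a b l m assume "a \<in> gpart A l" "b \<in> gpart A m"
    then show "a \<otimes>\<^bsub>A\<^esub> b \<in> gpart A (l + m)"
      and "a \<otimes>\<^bsub>A\<^esub> b = ksign A (l * m) (b \<otimes>\<^bsub>A\<^esub> a)"
      using mult unfolding A_simps ksign by blast+
  next
    fix a assume a: "a \<in> carrier A"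
    have "\<exists>c. (\<forall>n. c n \<in> gpart S n) \<and> finite {n. c n \<noteq> \<zero>\<^bsub>S\<^esub>} \<and>
        a = finsum S c {n. c n \<noteq> \<zero>\<^bsub>S\<^esub>}"
      using decomp a unfolding A_simps by (blast dest: ex1_implies_ex)
    then show "\<exists>c I. finite I \<and> (\<forall>n. c n \<in> gpart A n) \<and> a = finsum A c I"
      unfolding finsum A_simps by blast
  qed
  ultimately show ?thesis
    unfolding A_def by (rule graded_algebra.intro)
qed

theorem theorem5p3p1:
  fixes X :: "'m topology" and n :: nat and atlas :: "'m chart set" and ds :: "int list"
    and F :: "('m, 'a) graded_sheaf" and Q :: "'a vf" and k :: int
    and br :: "'a \<Rightarrow> 'a \<Rightarrow> 'a" and A :: "(real, 'a) graded_alg"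
  assumes "graded_manifold X n atlas ds F"
    and "A = global_functions X F"
    and "homological A Q"
    and "poisson_bracket A k br"
  shows "(PQ_manifold X n atlas ds F Q k br \<longleftrightarrow>
           left_dg_anti_morphism A k (forms_module A (lie_form A Q)) (vf_module A k (lie_vf A Q))
             (pi_sharp A k br)) \<and>
         (PQ_manifold X n atlas ds F Q k br \<longleftrightarrow>
           right_dg_morphism A k (forms_module A (\<lambda>p \<omega>. form_sign A 1 (lie_form A Q p \<omega>)))
             (vf_module A k (lie_vf A Q)) (pi_sharp A k br)) \<and>
         (left_dg_anti_morphism A k (forms_module A (lie_form A Q)) (vf_module A k (lie_vf A Q))
           (pi_sharp A k br) \<longleftrightarrow>
         (\<forall>p \<omega>. one_form A p \<omega> \<longrightarrow>
            pi_sharp A k br (p + 1) (lie_form A Q p \<omega>) =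
            vf_sign A 1 (lie_vf A Q (p - 1 + k) (pi_sharp A k br p \<omega>)))) \<and>
         (right_dg_morphism A k (forms_module A (\<lambda>p \<omega>. form_sign A 1 (lie_form A Q p \<omega>)))
           (vf_module A k (lie_vf A Q)) (pi_sharp A k br) \<longleftrightarrow>
         (\<forall>p \<omega>. one_form A p \<omega> \<longrightarrow>
            pi_sharp A k br (p + 1) (lie_form A Q p \<omega>) =
            vf_sign A 1 (lie_vf A Q (p - 1 + k) (pi_sharp A k br p \<omega>))))"
proof -
  interpret graded_algebra A
    unfolding assms(2) by (rule graded_algebra_global_functions[OF assms(1)])
  interpret graded_poisson_algebra A k br
    by unfold_locales (rule assms(4))
  have Q: "Q \<in> derivations A 1"
    using assms(3) by (simp add: homological_def)
  have "PQ_manifold X n atlas ds F Q k br \<longleftrightarrow> PQ_compatible A Q k br"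
    using assms by (simp add: PQ_manifold_def)
  then show ?thesis
    unfolding left_dg_anti_morphism_pi_sharp_iff[OF Q] right_dg_morphism_pi_sharp_iff[OF Q]
      PQ_compatible_iff[OF Q] by blast
qed

end
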